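(* A generic subshift $X$ in the space $\mathbf{S}$ of all subshifts has the following properties: (1) $X$ is a countable shift of finite type which is a union of finitely many orbits which are bi-asymptotic to periodic orbits; (2) the word complexity $c_X(n)$ of $X$ grows linearly; (3) the automorphism group $\mathrm{Aut}(X,\sigma_X)$ of $X$ is virtually free abelian of finite rank.
   Context: Let $\sigma$ be the shift on $\mathbb{Z}^{\mathbb{Z}}$ (product topology, $\mathbb{Z}$ discrete), $(\sigma x)_i=x_{i+1}$. A subshift is a nonempty compact set $X\subset\mathbb{Z}^{\mathbb{Z}}$ with $\sigma(X)=X$; it is then automatically contained in $\mathcal{A}^{\mathbb{Z}}$ for some finite $\mathcal{A}\subset\mathbb{Z}$. Write $\sigma_X=\sigma|_X$. $L_n(X)$ is the set of $n$-letter words occurring in points of $X$, and the word complexity function of $X$ is $c_X(n)=|L_n(X)|$. $\mathbf{S}$ is the set of all subshifts with the metric $d(X,Y)=2^{-\inf\{n\,:\,L_n(X)\ne L_n(Y)\}}$ ($d(X,X)=0$), which is equivalent to the Hausdorff metric. A property is generic in a space (equivalently, a generic element of the space has it) if the set of elements having the property is residual, i.e. contains a dense $G_\delta$ subset of the space. A shift of finite type is a subshift consisting of all points of $\mathcal{A}^{\mathbb{Z}}$ ($\mathcal{A}$ finite) that contain no word from some fixed finite set of words. An orbit $\{\sigma^i x\}_{i\in\mathbb{Z}}$ is bi-asymptotic to periodic orbits if there are periodic points $y,z$ with $x_i=y_i$ for all sufficiently negative $i$ and $x_i=z_i$ for all sufficiently large $i$ (periodic orbits themselves are allowed, and $y,z$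 may lie in different orbits). $\mathrm{Aut}(X,\sigma_X)$ is the group, under composition, of homeomorphisms of $X$ commuting with $\sigma_X$. A group is virtually free abelian of finite rank if it has a finite-index subgroup isomorphic to $\mathbb{Z}^r$ for some $r\ge0$.
   Formalization: In (2), "grows linearly" is taken as c_X(n)=O(n) for every such X and c_X(n)=Θ(n) when X is infinite; finite subshifts such as a single fixed point are isolated in S and have bounded complexity, so the lower bound cannot hold for them. *)

theory Defs
  imports
    "HOL-Analysis.Analysis"
    "HOL-Library.Landau_Symbols"
    "HOL-Algebra.Bij"
    "HOL-Algebra.Coset"
    "HOL-Algebra.Product_Groups"
begin

section \<open>Subshifts\<close>

text \<open>
  Points of the full shift are functions of type \<^typ>\<open>int \<Rightarrow> int\<close>. The library's topology on this
  type is the product topology, and the one on \<^typ>\<open>int\<close> is discrete.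
\<close>

definition shift :: "(int \<Rightarrow> int) \<Rightarrow> (int \<Rightarrow> int)" where
  "shift x = (\<lambda>i. x (i + 1))"

definition subshift :: "(int \<Rightarrow> int) set \<Rightarrow> bool" where
  "subshift X \<longleftrightarrow> X \<noteq> {} \<and> compact X \<and> shift ` X = X"

definition word :: "(int \<Rightarrow> int) \<Rightarrow> int \<Rightarrow> nat \<Rightarrow> int list" where
  "word x i n = map (\<lambda>j. x (i + int j)) [0..<n]"

definition lang :: "(int \<Rightarrow> int) set \<Rightarrow> nat \<Rightarrow> int list set" where
  "lang X n = {word x i n | x i. x \<in> X}"

definition complexity :: "(int \<Rightarrow> int) set \<Rightarrow> nat \<Rightarrow> nat" where
  "complexity X n = card (lang X n)"


section \<open>The space of subshifts\<close>

definition subshift_dist :: "(int \<Rightarrow> int) set \<Rightarrow> (int \<Rightarrow> int) set \<Rightarrow> real" where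
  "subshift_dist X Y = (if X = Y then 0 else 1 / 2 ^ Inf {n. lang X n \<noteq> lang Y n})"

lemma shift_invariant_translate:
  assumes "shift ` X = X" "x \<in> X"
  shows "(\<lambda>j. x (j + i)) \<in> X"
proof -
  have pos: "(\<lambda>j. z (j + int k)) \<in> X" if "z \<in> X" for z k
  proof (induction k)
    case 0
    then show ?case using that by simp
  next
    case (Suc k)
    have "shift (\<lambda>j. z (j + int k)) = (\<lambda>j. z (j + int (Suc k)))"
      by (auto simp: shift_def algebra_simps)
    then show ?case using Suc assms(1) by (metis imageI)
  qed
  have neg: "(\<lambda>j. z (j - int k)) \<in> X" if "z \<in> X" for z k
  proof (induction k)
    case 0
    then show ?case using that by simp
  next
    case (Suc k)
    then obtain y where y: "y \<in> X" "(\<lambda>j. z (j - int k)) = shift y"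
      using assms(1) by (metis imageE)
    have "y j = z (j - int (Suc k))" for j
      using fun_cong[OF y(2), of "j - 1"] by (simp add: shift_def algebra_simps)
    then have "y = (\<lambda>j. z (j - int (Suc k)))" by auto
    then show ?case using y by simp
  qed
  show ?thesis
    by (cases i rule: int_cases2) (use pos[OF assms(2)] neg[OF assms(2)] in auto)
qed

lemma subshift_subset_of_lang_eq:
  assumes X: "subshift X" and Y: "subshift Y" and eq: "\<And>n. lang X n = lang Y n"
  shows "X \<subseteq> Y"
proof
  fix x assume x: "x \<in> X"
  have "\<exists>y\<in>Y. \<forall>i. \<bar>i\<bar> \<le> int n \<longrightarrow> y i = x i" for n
  proof -
    have "word x (- int n) (2 * n + 1) \<in> lang Y (2 * n + 1)"
      unfolding eq[symmetric] using x by (auto simp: lang_def simp del: upt_Suc)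
    then obtain y k where y: "y \<in> Y" "word x (- int n) (2 * n + 1) = word y k (2 * n + 1)"
      by (auto simp: lang_def)
    have eq': "x (- int n + int j) = y (k + int j)" if "j < 2 * n + 1" for j
      using arg_cong[OF y(2), of "\<lambda>l. l ! j"] that by (simp add: word_def del: upt_Suc)
    let ?y = "\<lambda>j. y (j + (k + int n))"
    have "?y \<in> Y"
      using shift_invariant_translate y(1) Y unfolding subshift_def by blast
    moreover have "?y i = x i" if "\<bar>i\<bar> \<le> int n" for i
    proof -
      have "nat (i + int n) < 2 * n + 1" "int (nat (i + int n)) = i + int n"
        using that by linarith+
      then have "x (- int n + (i + int n)) = y (k + (i + int n))"
        using eq'[of "nat (i + int n)"] by simp
      moreover have "- int n + (i + int n) = i" "k + (i + int n) = i + (k + int n)"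
        by linarith+
      ultimately show ?thesis by metis
    qed
    ultimately show ?thesis by (intro bexI[of _ ?y]) auto
  qed
  then obtain y where y: "\<And>n. y n \<in> Y" "\<And>n i. \<bar>i\<bar> \<le> int n \<Longrightarrow> y n i = x i"
    by metis
  have "(\<lambda>n. y n i) \<longlonglongrightarrow> x i" for i
  proof (rule tendsto_eventually)
    show "\<forall>\<^sub>F n in sequentially. y n i = x i"
      using y(2) by (auto simp: eventually_sequentially intro!: exI[of _ "nat \<bar>i\<bar>"])
  qed
  then have "y \<longlonglongrightarrow> x"
    using limitin_componentwise[of "\<lambda>_. euclidean" UNIV y x sequentially]
    by (simp add: euclidean_product_topology limitin_canonical_iff)
  moreover have "closed Y"
  proof -
    have "Hausdorff_space (euclidean :: int topology)"
      unfolding Hausdorff_space_def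
    proof (intro allI impI)
      fix a b :: int
      assume "a \<in> topspace euclidean \<and> b \<in> topspace euclidean \<and> a \<noteq> b"
      then show "\<exists>U V. openin euclidean U \<and> openin euclidean V \<and> a \<in> U \<and> b \<in> V \<and> disjnt U V"
        by (intro exI[of _ "{a}"] exI[of _ "{b}"]) (auto simp: open_discrete)
    qed
    then have "Hausdorff_space (product_topology (\<lambda>_::int. euclidean :: int topology) UNIV)"
      by (intro Hausdorff_space_product_topology[THEN iffD2]) blast
    then have "Hausdorff_space (euclidean :: (int \<Rightarrow> int) topology)"
      by (simp add: euclidean_product_topology)
    moreover have "compactin euclidean Y"
      using Y by (simp add: subshift_def)
    ultimately show ?thesis
      using compactin_imp_closedin closed_closedin by blast
  qed
  ultimately show "x \<in> Y"
    using y(1) closed_sequentially by blast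
qed

interpretation subshift_space: Metric_space "Collect subshift" subshift_dist
proof
  show "0 \<le> subshift_dist X Y" for X Y
    by (simp add: subshift_dist_def)
  show "subshift_dist X Y = subshift_dist Y X" for X Y
    by (simp add: subshift_dist_def eq_commute)
  show "subshift_dist X Y = 0 \<longleftrightarrow> X = Y" for X Y
    by (simp add: subshift_dist_def)
  show "subshift_dist X Z \<le> subshift_dist X Y + subshift_dist Y Z"
    if "X \<in> Collect subshift" "Y \<in> Collect subshift" "Z \<in> Collect subshift" for X Y Z
  proof (cases "X = Z \<or> X = Y \<or> Y = Z")
    case True
    then show ?thesis by (auto simp: subshift_dist_def)
  next
    case False
    let ?D = "\<lambda>X Y. {n. lang X n \<noteq> lang Y n}"
    have "?D X Z \<noteq> {}"
      using subshift_subset_of_lang_eq[of X Z] subshift_subset_of_lang_eq[of Z X] that False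
      by auto
    then have "Inf (?D X Z) \<in> ?D X Z" by (rule Inf_nat_def1)
    then have "Inf (?D X Z) \<in> ?D X Y \<or> Inf (?D X Z) \<in> ?D Y Z" by auto
    then have "Inf (?D X Y) \<le> Inf (?D X Z) \<or> Inf (?D Y Z) \<le> Inf (?D X Z)"
      using wellorder_Inf_le1[of _ "?D X Y"] wellorder_Inf_le1[of _ "?D Y Z"] by blast
    then have "1 / 2 ^ Inf (?D X Z) \<le> (1 / 2 ^ Inf (?D X Y) :: real)
        \<or> 1 / 2 ^ Inf (?D X Z) \<le> (1 / 2 ^ Inf (?D Y Z) :: real)"
      by (auto simp: frac_le)
    moreover have "0 \<le> (1 / 2 ^ Inf (?D X Y) :: real)" "0 \<le> (1 / 2 ^ Inf (?D Y Z) :: real)"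
      by auto
    ultimately have "1 / 2 ^ Inf (?D X Z) \<le> (1 / 2 ^ Inf (?D X Y) + 1 / 2 ^ Inf (?D Y Z) :: real)"
      by linarith
    then show ?thesis
      using False by (simp add: subshift_dist_def)
  qed
qed

definition residual_in :: "'a topology \<Rightarrow> 'a set \<Rightarrow> bool" where
  "residual_in T A \<longleftrightarrow>
     A \<subseteq> topspace T \<and> (\<exists>G. G \<subseteq> A \<and> gdelta_in T G \<and> T closure_of G = topspace T)"

definition generic_in :: "'a topology \<Rightarrow> ('a \<Rightarrow> bool) \<Rightarrow> bool" where
  "generic_in T P \<longleftrightarrow> residual_in T {x \<in> topspace T. P x}"


section \<open>Properties of subshifts\<close>

definition shift_of_finite_type :: "(int \<Rightarrow> int) set \<Rightarrow> bool" where
  "shift_of_finite_type X \<longleftrightarrow> subshift X \<and>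
     (\<exists>A F. finite A \<and> finite F \<and>
        X = {x. range x \<subseteq> A \<and> (\<forall>w\<in>F. \<forall>i. word x i (length w) \<noteq> w)})"

definition orbit :: "(int \<Rightarrow> int) \<Rightarrow> (int \<Rightarrow> int) set" where
  "orbit x = range (\<lambda>i j. x (j + i))"

definition periodic_point :: "(int \<Rightarrow> int) \<Rightarrow> bool" where
  "periodic_point x \<longleftrightarrow> (\<exists>p>0. (shift ^^ p) x = x)"

definition biasymptotic_to_periodic :: "(int \<Rightarrow> int) \<Rightarrow> bool" where
  "biasymptotic_to_periodic x \<longleftrightarrow>
     (\<exists>y z. periodic_point y \<and> periodic_point z \<and>
        (\<forall>\<^sub>F i in at_bot. x i = y i) \<and> (\<forall>\<^sub>F i in at_top. x i = z i))"

text \<open>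
  A finite subshift has bounded complexity, and finite subshifts can be isolated points of the
  space of subshifts (for example a single fixed point), so a generic property cannot exclude
  them. Hence the linear lower bound is only required of infinite subshifts.
\<close>

definition linear_complexity :: "(int \<Rightarrow> int) set \<Rightarrow> bool" where
  "linear_complexity X \<longleftrightarrow>
     (\<lambda>n. real (complexity X n)) \<in> O(\<lambda>n. real n) \<and>
     (infinite X \<longrightarrow> (\<lambda>n. real (complexity X n)) \<in> \<Theta>(\<lambda>n. real n))"


section \<open>Automorphism groups\<close>

text \<open>
  As in \<^const>\<open>BijGroup\<close>, automorphisms are represented by functions that are \<^const>\<open>undefined\<close>
  outside \<open>X\<close>, so that each self-map of \<open>X\<close> has exactly one representative.
\<close>

definition Aut :: "(int \<Rightarrow> int) set \<Rightarrow> ((int \<Rightarrow> int) \<Rightarrow> (int \<Rightarrow> int)) monoid" where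
  "Aut X = (BijGroup X)\<lparr>carrier :=
     {f \<in> Bij X. (\<exists>g. homeomorphism X X f g) \<and> (\<forall>x\<in>X. f (shift x) = shift (f x))}\<rparr>"

lemma group_Aut:
  assumes "subshift X"
  shows "group (Aut X)"
proof -
  let ?C = "{f \<in> Bij X. (\<exists>g. homeomorphism X X f g) \<and> (\<forall>x\<in>X. f (shift x) = shift (f x))}"
  have sX: "shift x \<in> X" if "x \<in> X" for x
    using assms that by (auto simp: subshift_def)
  interpret B: group "BijGroup X" by (rule group_BijGroup)
  have car: "carrier (BijGroup X) = Bij X" by (simp add: BijGroup_def)
  have mult: "f \<otimes>\<^bsub>BijGroup X\<^esub> g = compose X f g" if "f \<in> Bij X" "g \<in> Bij X" for f g
    using that by (simp add: BijGroup_def)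
  have "subgroup ?C (BijGroup X)"
  proof (rule B.subgroupI)
    show "?C \<subseteq> carrier (BijGroup X)" by (auto simp: car)
    have "homeomorphism X X (\<lambda>x\<in>X. x) (\<lambda>x. x)"
      by (auto simp: homeomorphism_def intro!: continuous_on_id cong: continuous_on_cong)
    then have "(\<lambda>x\<in>X. x) \<in> ?C" using sX id_Bij by auto
    then show "?C \<noteq> {}" by blast
  next
    fix f assume f: "f \<in> ?C"
    then obtain g where g: "homeomorphism X X f g" by blast
    let ?h = "restrict (inv_into X f) X"
    have fB: "f \<in> Bij X" using f by blast
    have inv: "inv\<^bsub>BijGroup X\<^esub> f = ?h" using fB by (rule inv_BijGroup)
    have bij: "bij_betw f X X" using fB by (simp add: Bij_def)
    have hg: "?h x = g x" if "x \<in> X" for x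
    proof -
      have "g x \<in> X" "f (g x) = x" using g that by (auto simp: homeomorphism_def)
      then have "inv_into X f x = g x"
        using bij_betw_inv_into_left[OF bij, of "g x"] by simp
      then show ?thesis using that by simp
    qed
    have "homeomorphism X X ?h f"
      using homeomorphism_symD[OF g] hg
      by (auto intro: homeomorphism_cong)
    moreover have "?h (shift x) = shift (?h x)" if x: "x \<in> X" for x
    proof -
      have gx: "g x \<in> X" "f (g x) = x" using g x by (auto simp: homeomorphism_def)
      have "g (shift x) = g (f (shift (g x)))" using f gx by simp
      also have "\<dots> = shift (g x)" using g sX gx by (simp add: homeomorphism_def)
      finally show ?thesis using hg x sX by simp
    qed
    ultimately show "inv\<^bsub>BijGroup X\<^esub> f \<in> ?C"
      unfolding inv using restrict_inv_into_Bij[OF fB] by blast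
  next
    fix f f' assume f: "f \<in> ?C" and f': "f' \<in> ?C"
    obtain g g' where g: "homeomorphism X X f g" and g': "homeomorphism X X f' g'"
      using f f' by blast
    have "homeomorphism X X (f \<circ> f') (g' \<circ> g)"
      using homeomorphism_compose[OF g' g] .
    then have "homeomorphism X X (compose X f f') (g' \<circ> g)"
      by (rule homeomorphism_cong) (auto simp: compose_def)
    moreover have f'X: "f' x \<in> X" if "x \<in> X" for x
      using g' that by (auto simp: homeomorphism_def)
    moreover have "compose X f f' (shift x) = shift (compose X f f' x)" if "x \<in> X" for x
      using f f' sX[OF that] f'X[OF that] that by (simp add: compose_eq)
    moreover have "compose X f f' \<in> Bij X"
      using f f' by (intro compose_Bij) auto
    moreover have "f \<otimes>\<^bsub>BijGroup X\<^esub> f' = compose X f f'"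
      using f f' by (intro mult) auto
    ultimately show "f \<otimes>\<^bsub>BijGroup X\<^esub> f' \<in> ?C"
      by auto
  qed
  then show ?thesis
    unfolding Aut_def by (rule subgroup.subgroup_is_group) (rule B.is_group)
qed

definition virtually_free_abelian_of_finite_rank :: "('a, 'b) monoid_scheme \<Rightarrow> bool" where
  "virtually_free_abelian_of_finite_rank G \<longleftrightarrow>
     (\<exists>H r. subgroup H G \<and> finite (rcosets\<^bsub>G\<^esub> H) \<and>
        G\<lparr>carrier := H\<rparr> \<cong> product_group {..<r::nat} (\<lambda>_. integer_group))"

end

theory Submission
  imports Defs
begin

text \<open>
  The subshifts with the stated properties that are moreover isolated points of the space are
  dense. A set of isolated points is open, so the properties are generic
  (\<open>generic_of_dense_isolated\<close>).

  To approximate a subshift \<open>X\<close>, consider the finite graph whose vertices are the words of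
  length \<open>n\<close> of \<open>X\<close> and whose bi-infinite walks are the sequences having only such words. It has
  no dead ends. Through every vertex \<open>v\<close> there is an eventually periodic walk: if \<open>v\<close> lies on a
  cycle, the walk is periodic, and otherwise it comes from a cycle, passes through \<open>v\<close> and ends
  with a cycle in a terminal strongly connected component (\<open>walk_through_vertex\<close>). In the second
  case the right end of the walk has no vertex in common with the left end of any such walk,
  itself included (\<open>transient_walks_separated\<close>), because from a terminal component no vertex can be reached
  that lies on no cycle. One walk for each vertex, together with their periodic ends, gives
  finitely many sequences, and the union \<open>Y\<close> of their orbits has the same words of length \<open>n\<close>
  as \<open>X\<close> (\<open>separated_family_of_lang\<close>).

  Let \<open>P\<close> be a common period of all ends, and call a position \<open>i\<close> of a sequence \<open>y\<close> with
  \<open>y (i + P) \<noteq> y i\<close> a defect. In each of the chosen sequences the defects lie in a bounded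
  interval. Suppose that all long words of \<open>y\<close> are words of \<open>Y\<close>. If \<open>y\<close> has no defect, it is one
  of the periodic ends. If it has one, then near this defect it follows one of the chosen
  sequences \<open>x\<close>, and it cannot leave \<open>x\<close> later: to do so it would have to pass from the right end
  of one aperiodic sequence to the left end of another, which the separation of ends forbids
  (\<open>agree_right\<close>, \<open>agree_left\<close>). Hence \<open>Y\<close> is of finite type (\<open>shift_of_finite_type_points\<close>) and
  is the only subshift with its set of long words (\<open>isolated_points\<close>).

  The complexity of \<open>Y\<close> is at most linear because the tails contribute boundedly many words, and
  at least linear if \<open>Y\<close> is infinite because a word that covers the last defect of an aperiodic
  sequence shows where this defect lies in it (\<open>linear_complexity_points\<close>).

  For the automorphism group, consider the automorphisms that preserve every orbit of the
  \<open>P\<close>-th power of the shift. There are finitely many such orbits, so they form a subgroup of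
  finite index. Such an automorphism fixes the periodic points and translates the \<open>i\<close>-th
  aperiodic orbit by a multiple \<open>P * c i\<close>. All choices of \<open>c\<close> occur: since the ends have period
  \<open>P\<close>, these translations agree with the identity far away from the defects, and so they fit
  together continuously. The subgroup is thus a free abelian group whose rank is the number of
  aperiodic orbits (\<open>virtually_free_abelian_Aut_points\<close>).
\<close>


section \<open>Eventually periodic bi-infinite sequences\<close>

definition translate :: "int \<Rightarrow> (int \<Rightarrow> 'a) \<Rightarrow> int \<Rightarrow> 'a" where
  "translate k x = (\<lambda>j. x (j + k))"

definition has_period :: "int \<Rightarrow> (int \<Rightarrow> 'a) \<Rightarrow> bool" where
  "has_period p x \<longleftrightarrow> (\<forall>i. x (i + p) = x i)"

text \<open>
  On both half-lines the period is stated in the direction away from the origin, so that it can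
  be iterated.
\<close>

definition periodic_outside :: "int \<Rightarrow> int \<Rightarrow> (int \<Rightarrow> 'a) \<Rightarrow> bool" where
  "periodic_outside p m x \<longleftrightarrow> (\<forall>i\<ge>m. x (i + p) = x i) \<and> (\<forall>i\<le>-m. x (i - p) = x i)"

lemma translate_0 [simp]: "translate 0 x = x"
  by (simp add: translate_def)

lemma translate_translate [simp]: "translate k (translate l x) = translate (k + l) x"
  by (simp add: translate_def add.assoc)

lemma shift_eq_translate: "shift = translate 1"
  by (simp add: shift_def translate_def fun_eq_iff)

lemma funpow_shift: "(shift ^^ n) x = translate (int n) x"
  by (induction n) (simp_all add: shift_eq_translate add.commute)

lemma orbit_eq_range_translate: "orbit x = range (\<lambda>k. translate k x)"
  by (simp add: orbit_def translate_def)

lemma translate_in_orbit: "translate k x \<in> orbit x"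
  by (simp add: orbit_eq_range_translate)

lemma orbit_translate: "orbit (translate k x) = orbit x"
proof -
  have "translate l x \<in> range (\<lambda>l. translate l (translate k x))" for l
    by (rule range_eqI[of _ _ "l - k"]) simp
  then show ?thesis
    by (auto simp: orbit_eq_range_translate)
qed

lemma has_period_mult:
  assumes "has_period p x"
  shows "x (i + p * k) = x i"
proof -
  have nat: "x (i + p * int n) = x i" for i n
  proof (induction n)
    case (Suc n)
    have "x (i + p * int (Suc n)) = x (i + p * int n + p)"
      by (simp add: algebra_simps)
    then show ?case
      using Suc assms by (simp add: has_period_def)
  qed simp
  show ?thesis
  proof (cases k rule: int_cases2)
    case (nonneg n)
    then show ?thesis by (simp add: nat)
  next
    case (nonpos n)
    then show ?thesis using nat[of "i + p * k" n] by simp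
  qed
qed

lemma has_period_dvd: "has_period p x \<Longrightarrow> p dvd q \<Longrightarrow> has_period q x"
  unfolding has_period_def[of q] by (auto simp: has_period_mult)

lemma translate_has_period: "has_period p x \<Longrightarrow> translate (p * k) x = x"
  by (simp add: translate_def has_period_mult)

lemma has_period_iff_translate: "has_period p x \<longleftrightarrow> translate p x = x"
  by (auto simp: has_period_def translate_def fun_eq_iff)

lemma periodic_outside_right:
  assumes "periodic_outside p m x" "p > 0" "i \<ge> m"
  shows "x (i + p * int k) = x i"
proof (induction k)
  case (Suc k)
  have "x (i + p * int (Suc k)) = x (i + p * int k + p)"
    by (simp add: algebra_simps)
  also have "\<dots> = x (i + p * int k)"
  proof -
    have "i + p * int k \<ge> m" using assms(2,3) by (simp add: add_increasing2)
    then show ?thesis using assms(1) by (simp add: periodic_outside_def)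
  qed
  finally show ?case using Suc by simp
qed simp

lemma periodic_outside_left:
  assumes "periodic_outside p m x" "p > 0" "i \<le> -m"
  shows "x (i - p * int k) = x i"
proof (induction k)
  case (Suc k)
  have "x (i - p * int (Suc k)) = x (i - p * int k - p)"
    by (simp add: algebra_simps)
  also have "\<dots> = x (i - p * int k)"
  proof -
    have "0 \<le> p * int k" using assms(2) by simp
    then have "i - p * int k \<le> -m" using assms(3) by linarith
    then show ?thesis using assms(1) by (simp add: periodic_outside_def)
  qed
  finally show ?case using Suc by simp
qed simp

lemma periodic_outside_mono:
  assumes "periodic_outside p m x" "p > 0" "p dvd q" "q > 0" "m \<le> m'"
  shows "periodic_outside q m' x"
proof -
  obtain c where c: "q = p * c" using assms(3) by blast
  then have "c > 0" using assms(2,4) by (simp add: zero_less_mult_iff)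
  then obtain n where q: "q = p * int n" using c by (metis zero_less_imp_eq_int)
  show ?thesis
    unfolding periodic_outside_def q
    using periodic_outside_right[OF assms(1,2)] periodic_outside_left[OF assms(1,2)] assms(5)
    by auto
qed

lemma periodic_outside_of_has_period:
  assumes "has_period p x"
  shows "periodic_outside p m x"
  using assms has_period_mult[OF assms, of _ "-1"] by (simp add: has_period_def periodic_outside_def)

lemma has_period_eq_of_eq_on_period:
  fixes y z :: "int \<Rightarrow> 'a"
  assumes "has_period p y" "has_period p z" "p > 0" "\<And>k. 0 \<le> k \<Longrightarrow> k < p \<Longrightarrow> y (a + k) = z (b + k)"
  shows "y (a + k) = z (b + k)"
proof -
  have "u (c + k) = u (c + k mod p)" if "has_period p u" for u :: "int \<Rightarrow> 'a" and c
    using has_period_mult[OF that, of "c + k mod p" "k div p"] by (simp add: add.assoc)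
  from this[OF assms(1)] this[OF assms(2)] show ?thesis
    using assms(3) assms(4)[of "k mod p"] by simp
qed

lemma nonneg_int_decomp:
  fixes p j :: int
  assumes "p > 0" "j \<ge> 0"
  obtains r n where "j = r + p * int n" "0 \<le> r" "r < p" "r = j mod p"
proof
  have "j mod p + p * (j div p) = j" by simp
  moreover have "int (nat (j div p)) = j div p"
    using assms by (simp add: pos_imp_zdiv_nonneg_iff)
  ultimately show "j = j mod p + p * int (nat (j div p))" by metis
qed (use assms in simp_all)

lemma periodic_outside_right_mod:
  assumes "periodic_outside p m x" "p > 0" "i \<ge> m"
  shows "x i = x (m + (i - m) mod p)"
proof -
  have "i - m \<ge> 0" using assms(3) by simp
  then obtain r n where n: "i - m = r + p * int n" "0 \<le> r" "r < p" and r: "r = (i - m) mod p"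
    by (rule nonneg_int_decomp[OF assms(2)])
  then have i: "i = m + r + p * int n" by linarith
  show ?thesis
    unfolding r[symmetric] using periodic_outside_right[OF assms(1,2), of "m + r" n] n by (simp add: i)
qed

lemma periodic_outside_left_mod:
  assumes "periodic_outside p m x" "p > 0" "i \<le> -m"
  shows "x i = x (- m - (- m - i) mod p)"
proof -
  have "- m - i \<ge> 0" using assms(3) by simp
  then obtain r n where n: "- m - i = r + p * int n" "0 \<le> r" "r < p" and r: "r = (- m - i) mod p"
    by (rule nonneg_int_decomp[OF assms(2)])
  then have i: "i = - m - r - p * int n" by linarith
  show ?thesis
    unfolding r[symmetric] using periodic_outside_left[OF assms(1,2), of "- m - r" n] n by (simp add: i)
qed

lemma periodic_outside_eqI:
  assumes "periodic_outside p m x" "periodic_outside p m y" "p > 0" "\<And>i. \<bar>i\<bar> \<le> \<bar>m\<bar> + p \<Longrightarrow> x i = y i"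
  shows "x = y"
proof
  fix i
  have mod: "0 \<le> j mod p" "j mod p < p" for j
    using assms(3) by simp_all
  consider "i \<ge> m" | "i \<le> -m" | "\<bar>i\<bar> \<le> \<bar>m\<bar> + p"
    using assms(3) by linarith
  then show "x i = y i"
  proof cases
    case 1
    have "\<bar>m + (i - m) mod p\<bar> \<le> \<bar>m\<bar> + p" using mod[of "i - m"] by linarith
    then show ?thesis
      using 1 assms periodic_outside_right_mod[of p m] by metis
  next
    case 2
    have "\<bar>- m - (- m - i) mod p\<bar> \<le> \<bar>m\<bar> + p" using mod[of "- m - i"] by linarith
    then show ?thesis
      using 2 assms periodic_outside_left_mod[of p m] by metis
  qed (use assms in auto)
qed

lemma right_end_exists:
  assumes "periodic_outside p m x" "p > 0"
  shows "\<exists>z. has_period p z \<and> (\<forall>i\<ge>m. z i = x i)"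
proof (intro exI conjI allI impI)
  let ?z = "\<lambda>i. x (m + (i - m) mod p)"
  have "(i + p - m) mod p = (i - m) mod p" for i
    by (metis add_diff_eq diff_add_eq mod_add_self2)
  then show "has_period p ?z"
    by (simp add: has_period_def)
  fix i assume "i \<ge> m"
  then show "?z i = x i"
    using periodic_outside_right_mod[OF assms] by metis
qed

lemma left_end_exists:
  assumes "periodic_outside p m x" "p > 0"
  shows "\<exists>z. has_period p z \<and> (\<forall>i\<le>-m. z i = x i)"
proof -
  have "periodic_outside p m (\<lambda>i. x (- i))"
    using assms(1) unfolding periodic_outside_def
    by (metis add.commute minus_add_distrib minus_le_iff minus_minus neg_le_iff_le uminus_add_conv_diff)
  then obtain z where z: "has_period p z" "\<And>i. i \<ge> m \<Longrightarrow> z i = x (- i)"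
    using right_end_exists assms(2) by blast
  have "has_period p (\<lambda>i. z (- i))"
    unfolding has_period_def
  proof
    fix i
    show "z (- (i + p)) = z (- i)"
      using has_period_mult[OF z(1), of "- (i + p)" 1] by simp
  qed
  then show ?thesis
    using z(2) by (intro exI[of _ "\<lambda>i. z (- i)"]) force
qed

text \<open>
  If a translation by \<open>k - l\<close> fixes \<open>x\<close>, then every position can be moved by multiples of
  \<open>k - l\<close> into the half-line on which \<open>x\<close> has period \<open>p\<close>. Hence a sequence that is eventually
  \<open>p\<close>-periodic but not \<open>p\<close>-periodic has a free orbit.
\<close>

lemma period_of_translate_eq:
  assumes out: "periodic_outside p m x" "p > 0" and "translate k x = translate l x" "k \<noteq> l"
  shows "has_period p x"
proof -
  define d where "d = \<bar>k - l\<bar>"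
  have "translate (k - l) x = x" "translate (l - k) x = x"
    using arg_cong[OF assms(3), of "translate (- l)"] arg_cong[OF assms(3), of "translate (- k)"]
    by simp_all
  then have "has_period d x"
    by (auto simp: d_def abs_if has_period_iff_translate)
  show ?thesis
    unfolding has_period_def
  proof
    fix i
    define t where "t = \<bar>m - i\<bar>"
    have "d \<ge> 1" using assms(4) by (simp add: d_def)
    then have "d * t \<ge> t" using mult_right_mono[of 1 d t] by (simp add: t_def)
    then have "i + d * t \<ge> m" by (simp add: t_def)
    then have "x (i + d * t + p) = x (i + d * t)"
      using out by (simp add: periodic_outside_def)
    then show "x (i + p) = x i"
      using has_period_mult[OF \<open>has_period d x\<close>, of "i + p" t]
        has_period_mult[OF \<open>has_period d x\<close>, of i t]
      by (simp add: algebra_simps)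
  qed
qed


section \<open>Walks in finite graphs\<close>

definition walk :: "('a \<times> 'a) set \<Rightarrow> (int \<Rightarrow> 'a) \<Rightarrow> bool" where
  "walk E x \<longleftrightarrow> (\<forall>i. (x i, x (i + 1)) \<in> E)"

lemma walk_reach:
  assumes "walk E x" "i \<le> j"
  shows "(x i, x j) \<in> E\<^sup>*"
  using assms(2)
proof (induction j rule: int_ge_induct)
  case (step j)
  then show ?case
    using assms(1) unfolding walk_def by (meson rtrancl.rtrancl_into_rtrancl)
qed simp

lemma cycle_walk:
  assumes "(s, s) \<in> E\<^sup>+"
  obtains x p where "p > 0" "walk E x" "has_period p x" "x 0 = s"
proof -
  obtain n f where n: "n > 0" and f: "f 0 = s" "f n = s" "\<And>i. i < n \<Longrightarrow> (f i, f (Suc i)) \<in> E"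
    using assms by (auto simp: trancl_power relpow_fun_conv)
  let ?x = "\<lambda>i. f (nat (i mod int n))"
  have "walk E ?x"
    unfolding walk_def
  proof
    fix i
    have lt: "nat (i mod int n) < n"
      using n by (simp add: nat_less_iff)
    have "?x (i + 1) = f (Suc (nat (i mod int n)))"
    proof (cases "i mod int n + 1 = int n")
      case True
      then have "(i + 1) mod int n = 0" by (metis mod_add_left_eq mod_self)
      moreover have "Suc (nat (i mod int n)) = n" using True lt by linarith
      ultimately show ?thesis using f by simp
    next
      case False
      moreover have "0 \<le> i mod int n" "i mod int n < int n" using n by simp_all
      ultimately have "(i + 1) mod int n = i mod int n + 1"
        by (smt (verit) mod_add_left_eq mod_pos_pos_trivial)
      then show ?thesis using n by (simp add: nat_add_distrib)
    qed
    then show "(?x i, ?x (i + 1)) \<in> E" using f(3)[OF lt] by simp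
  qed
  moreover have "has_period (int n) ?x"
    by (simp add: has_period_def)
  ultimately show ?thesis
    using that[of "int n" ?x] n f by simp
qed

text \<open>
  A vertex reachable from \<open>v\<close> whose own reachable set has the least cardinality lies in a
  terminal strongly connected component.
\<close>

lemma reach_sink:
  assumes "finite (E\<^sup>* `` {v})"
  obtains t where "(v, t) \<in> E\<^sup>*" "\<And>u. (t, u) \<in> E\<^sup>* \<Longrightarrow> (u, t) \<in> E\<^sup>*"
proof -
  define t where "t = arg_min (\<lambda>t. card (E\<^sup>* `` {t})) (\<lambda>t. (v, t) \<in> E\<^sup>*)"
  have t: "(v, t) \<in> E\<^sup>*" and min: "\<And>u. (v, u) \<in> E\<^sup>* \<Longrightarrow> card (E\<^sup>* `` {t}) \<le> card (E\<^sup>* `` {u})"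
    using arg_min_nat_lemma[of "\<lambda>t. (v, t) \<in> E\<^sup>*" v "\<lambda>t. card (E\<^sup>* `` {t})"] by (auto simp: t_def)
  have "(u, t) \<in> E\<^sup>*" if u: "(t, u) \<in> E\<^sup>*" for u
  proof -
    have sub: "E\<^sup>* `` {u} \<subseteq> E\<^sup>* `` {t}" "E\<^sup>* `` {t} \<subseteq> E\<^sup>* `` {v}"
      using u t by auto
    have "card (E\<^sup>* `` {t}) \<le> card (E\<^sup>* `` {u})"
      using min t u by (meson rtrancl_trans)
    then have "E\<^sup>* `` {u} = E\<^sup>* `` {t}"
      using sub assms by (meson card_seteq finite_subset)
    then show ?thesis by auto
  qed
  with t that show ?thesis by blast
qed

text \<open>
  The walks used for vertices \<open>v\<close> that lie on no cycle: the far left of the walk leads into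
  \<open>v\<close>, and its far right stays in a strongly connected component that cannot be left.
\<close>

definition transient_walk :: "('a \<times> 'a) set \<Rightarrow> 'a \<Rightarrow> int \<Rightarrow> (int \<Rightarrow> 'a) \<Rightarrow> bool" where
  "transient_walk E v m x \<longleftrightarrow> (v, v) \<notin> E\<^sup>+ \<and> (\<forall>i\<le>-m. (x i, v) \<in> E\<^sup>+) \<and>
     (\<forall>i\<ge>m. \<forall>u. (x i, u) \<in> E\<^sup>* \<longrightarrow> (u, x i) \<in> E\<^sup>*)"

lemma transient_walk_mono: "transient_walk E v m x \<Longrightarrow> m \<le> m' \<Longrightarrow> transient_walk E v m' x"
  by (simp add: transient_walk_def)

text \<open>
  A common vertex would be in a terminal component and would lead into \<open>v'\<close>; then \<open>v'\<close> would
  lead back to it and lie on a cycle. This is why no walk can first follow the end of one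
  transient walk and then the beginning of another: the property that makes the subshift built
  from such walks isolated.
\<close>

lemma transient_walks_separated:
  assumes "transient_walk E v m x" "transient_walk E v' m' x'" "i \<ge> m" "j \<le> -m'"
  shows "x i \<noteq> x' j"
proof
  assume eq: "x i = x' j"
  then have "(x i, v') \<in> E\<^sup>+"
    using assms by (simp add: transient_walk_def)
  moreover from this have "(v', x i) \<in> E\<^sup>*"
    using assms by (simp add: transient_walk_def trancl_into_rtrancl)
  ultimately have "(v', v') \<in> E\<^sup>+" by simp
  then show False
    using assms by (simp add: transient_walk_def)
qed

text \<open>
  If \<open>v\<close> lies on a cycle, this cycle is traversed forever. Otherwise the walk starts with a
  cycle through some \<open>s\<close> from which \<open>v\<close> is reachable, passes through \<open>v\<close>, and ends with a cycle
  through some \<open>t\<close> in a terminal component; \<open>s\<close> is found as a sink of the reversed graph, where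
  it has a successor because there are no dead ends.
\<close>

lemma walk_through_vertex:
  assumes V: "finite V" "E \<subseteq> V \<times> V" and v: "v \<in> V"
    and succ: "\<And>v. v \<in> V \<Longrightarrow> \<exists>u. (v, u) \<in> E" and pred: "\<And>v. v \<in> V \<Longrightarrow> \<exists>u. (u, v) \<in> E"
  obtains x p m where "walk E x" "v \<in> range x" "p > 0" "periodic_outside p m x"
    "has_period p x \<or> transient_walk E v m x"
proof (cases "(v, v) \<in> E\<^sup>+")
  case True
  then obtain x p where "p > 0" "walk E x" "has_period p x" "x 0 = v"
    by (rule cycle_walk)
  then show ?thesis
    using that[of x p 0] periodic_outside_of_has_period by (metis rangeI)
next
  case False
  have reach_V: "F\<^sup>* `` {v} \<subseteq> V" if "F \<subseteq> V \<times> V" for F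
  proof
    fix u assume "u \<in> F\<^sup>* `` {v}"
    then have "(v, u) \<in> F\<^sup>*" by simp
    then show "u \<in> V"
      by (induction rule: rtrancl_induct) (use v that in auto)
  qed
  have "finite (E\<^sup>* `` {v})" "finite ((E\<inverse>)\<^sup>* `` {v})"
    using reach_V[of E] reach_V[of "E\<inverse>"] V finite_subset by blast+
  then obtain t s where t: "(v, t) \<in> E\<^sup>*" "\<And>u. (t, u) \<in> E\<^sup>* \<Longrightarrow> (u, t) \<in> E\<^sup>*"
    and s: "(s, v) \<in> E\<^sup>*" "\<And>u. (u, s) \<in> E\<^sup>* \<Longrightarrow> (s, u) \<in> E\<^sup>*"
    by (metis reach_sink rtrancl_converse converse_iff)
  have "t \<in> V" "s \<in> V"
    using reach_V[of E] reach_V[of "E\<inverse>"] V t(1) s(1) by (auto simp: rtrancl_converse)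
  then obtain t' s' where "(t, t') \<in> E" "(s', s) \<in> E"
    using succ pred by meson
  then have tt: "(t, t) \<in> E\<^sup>+" and ss: "(s, s) \<in> E\<^sup>+"
    using t(2)[of t'] s(2)[of s']
    by (auto intro: rtrancl_into_trancl1[of s s'] rtrancl_into_trancl2[of t t'])
  obtain f p where f: "p > 0" "walk E f" "has_period p f" "f 0 = s"
    using ss by (rule cycle_walk)
  obtain g q where g: "q > 0" "walk E g" "has_period q g" "g 0 = t"
    using tt by (rule cycle_walk)
  obtain a b h h' where h: "h 0 = s" "h a = v" "\<And>i. i < a \<Longrightarrow> (h i, h (Suc i)) \<in> E"
    and h': "h' 0 = v" "h' b = t" "\<And>i. i < b \<Longrightarrow> (h' i, h' (Suc i)) \<in> E"
    using s(1) t(1) by (auto simp: rtrancl_power relpow_fun_conv)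
  \<comment> \<open>The neighbouring pieces agree where they meet, as shown by \<open>x2\<close>, \<open>x3\<close> and \<open>x4\<close>.\<close>
  define x where "x i = (if i \<le> 0 then f i else if i \<le> int a then h (nat i)
     else if i \<le> int a + int b then h' (nat (i - int a)) else g (i - int a - int b))" for i
  have x1: "x i = f i" if "i \<le> 0" for i
    using that by (simp add: x_def)
  have x2: "x i = h (nat i)" if "0 \<le> i" "i \<le> int a" for i
    using that f(4) h(1) by (auto simp: x_def)
  have x3: "x i = h' (nat (i - int a))" if "int a \<le> i" "i \<le> int a + int b" for i
    using that x2[of i] h(2) h'(1) f(4) h(1) by (cases "i = int a") (auto simp: x_def)
  have x4: "x i = g (i - int a - int b)" if "int a + int b \<le> i" for i
    using that x3[of i] h'(2) g(4) by (cases "i = int a + int b") (auto simp: x_def)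
  have walk: "walk E x"
    unfolding walk_def
  proof
    fix i
    consider "i < 0" | "0 \<le> i" "i < int a" | "int a \<le> i" "i < int a + int b" | "int a + int b \<le> i"
      by linarith
    then show "(x i, x (i + 1)) \<in> E"
    proof cases
      case 1
      then show ?thesis using f(2) by (simp add: x1 walk_def)
    next
      case 2
      then have "nat (i + 1) = Suc (nat i)" "nat i < a" by linarith+
      then show ?thesis using h(3)[of "nat i"] 2 by (simp add: x2)
    next
      case 3
      then have "nat (i + 1 - int a) = Suc (nat (i - int a))" "nat (i - int a) < b" by linarith+
      then show ?thesis using h'(3)[of "nat (i - int a)"] 3 by (simp add: x3)
    next
      case 4
      have "x (i + 1) = g (i - int a - int b + 1)"
        using 4 x4[of "i + 1"] by (simp add: algebra_simps)
      then show ?thesis using g(2) 4 by (simp add: x4 walk_def)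
    qed
  qed
  have xa: "x (int a) = v" using h(2) by (simp add: x2)
  have pq: "periodic_outside (p * q) (int a + int b) x"
  proof -
    have "x (i + p * q) = x i" if "i \<ge> int a + int b" for i
    proof -
      have "i + p * q \<ge> int a + int b"
        using that f(1) g(1) by (simp add: add_increasing2)
      then show ?thesis
        using that has_period_mult[OF g(3), of "i - int a - int b" p]
        by (simp add: x4 algebra_simps)
    qed
    moreover have "x (i - p * q) = x i" if "i \<le> - (int a + int b)" for i
    proof -
      have "i \<le> 0" "i - p * q \<le> 0"
        using that f(1) g(1) mult_pos_pos[of p q] by linarith+
      then show ?thesis
        using has_period_mult[OF f(3), of i "-q"] by (simp add: x1 algebra_simps)
    qed
    ultimately show ?thesis by (simp add: periodic_outside_def)
  qed
  have "transient_walk E v (int a + int b) x"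
    unfolding transient_walk_def
  proof (intro conjI allI impI)
    fix i assume "i \<le> - (int a + int b)"
    then have "(x i, s) \<in> E\<^sup>*"
      using walk_reach[OF walk, of i 0] f(4) by (simp add: x1)
    then show "(x i, v) \<in> E\<^sup>+"
      using s(1) ss by (meson rtrancl_trancl_trancl trancl_rtrancl_trancl)
  next
    fix i u assume i: "i \<ge> int a + int b" and u: "(x i, u) \<in> E\<^sup>*"
    have "(t, x i) \<in> E\<^sup>*"
      using walk_reach[OF walk i] g(4) by (simp add: x4)
    then show "(u, x i) \<in> E\<^sup>*"
      using u t(2) by (meson rtrancl_trans)
  qed (fact False)
  then show ?thesis
    using that[OF walk _ _ pq] xa f(1) g(1) by (metis mult_pos_pos rangeI)
qed

section \<open>Words and orbits\<close>

lemma length_word [simp]: "length (word x i n) = n"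
  by (simp add: word_def)

lemma nth_word [simp]: "k < n \<Longrightarrow> word x i n ! k = x (i + int k)"
  by (simp add: word_def)

lemma word_eq_iff: "word x i n = word y j n \<longleftrightarrow> (\<forall>k<n. x (i + int k) = y (j + int k))"
  by (simp add: list_eq_iff_nth_eq)

lemma word_translate: "word (translate k x) i n = word x (i + k) n"
  by (simp add: word_eq_iff translate_def add.assoc add.left_commute add.commute)

lemma word_in_lang: "x \<in> X \<Longrightarrow> word x i n \<in> lang X n"
  by (auto simp: lang_def)

section \<open>Finite unions of eventually periodic orbits\<close>

locale eventually_periodic_family =
  fixes R :: "(int \<Rightarrow> int) set" and P M :: int
  assumes finite_R: "finite R" and P_pos: "P > 0" and M_nonneg: "M \<ge> 0"
    and outside: "\<And>x. x \<in> R \<Longrightarrow> periodic_outside P M x"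
begin

definition points :: "(int \<Rightarrow> int) set" where
  "points = (\<Union>x\<in>R. orbit x)"

lemma pointsE:
  assumes "y \<in> points"
  obtains x k where "x \<in> R" "y = translate k x"
  using assms by (auto simp: points_def orbit_eq_range_translate)

lemma translate_in_points:
  assumes "y \<in> points"
  shows "translate k y \<in> points"
proof -
  obtain x l where "x \<in> R" "y = translate l x" using assms by (rule pointsE)
  then show ?thesis
    unfolding points_def by (intro UN_I[of x]) (simp_all add: translate_in_orbit)
qed

lemma R_subset_points: "x \<in> R \<Longrightarrow> x \<in> points"
  unfolding points_def using translate_in_orbit[of 0 x] by (intro UN_I[of x]) simp_all

lemma shift_points: "shift ` points = points"
  unfolding shift_eq_translate
proof (intro equalityI subsetI)
  fix y assume y: "y \<in> points"
  have "y = translate 1 (translate (-1) y)" by simp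
  then show "y \<in> translate 1 ` points"
    using translate_in_points[OF y] by (rule image_eqI)
next
  fix y assume "y \<in> translate 1 ` points"
  then obtain x where "x \<in> points" "y = translate 1 x" by (rule imageE)
  then show "y \<in> points"
    using translate_in_points by simp
qed

lemma countable_points: "countable points"
  using finite_R unfolding points_def orbit_eq_range_translate by (simp add: countable_finite)

lemma lang_points: "lang points n = {word x i n | x i. x \<in> R}"
proof -
  have "\<exists>x j. word y i n = word x j n \<and> x \<in> R" if "y \<in> points" for y i
  proof -
    from that obtain x k where "x \<in> R" "y = translate k x" by (rule pointsE)
    then show ?thesis by (metis word_translate)
  qed
  then have "lang points n \<subseteq> {word x i n | x i. x \<in> R}"
    unfolding lang_def by blast
  moreover have "{word x i n | x i. x \<in> R} \<subseteq> lang points n"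
    unfolding lang_def using R_subset_points by blast
  ultimately show ?thesis by (rule equalityI)
qed

lemma biasymptotic:
  assumes "x \<in> R"
  shows "biasymptotic_to_periodic x"
proof -
  have per: "periodic_point z" if "has_period P z" for z
    unfolding periodic_point_def
    using P_pos that
    by (intro exI[of _ "nat P"]) (simp add: funpow_shift has_period_iff_translate)
  obtain y where y: "has_period P y" "\<forall>i\<le>-M. y i = x i"
    using left_end_exists[OF outside[OF assms] P_pos] by blast
  obtain z where z: "has_period P z" "\<forall>i\<ge>M. z i = x i"
    using right_end_exists[OF outside[OF assms] P_pos] by blast
  have "\<forall>\<^sub>F i in at_bot. x i = y i" "\<forall>\<^sub>F i in at_top. x i = z i"
    using y(2) z(2)
    by (auto simp: eventually_at_bot_linorder eventually_at_top_linorder intro: exI[of _ "-M"] exI[of _ M])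
  then show ?thesis
    unfolding biasymptotic_to_periodic_def
    by (intro exI[of _ y] exI[of _ z] conjI per y(1) z(1))
qed


subsection \<open>Word complexity\<close>

text \<open>
  The words in the right tail repeat with period \<open>P\<close>, and so do those that end before the left
  tail does. Only about \<open>n\<close> starting positions are left, which makes the complexity at most
  linear.
\<close>

lemma word_near_origin:
  assumes "x \<in> R"
  shows "\<exists>j\<in>{- M - P - int n..M + P}. word x i n = word x j n"
proof -
  note out = outside[OF assms]
  consider "i \<ge> M" | "i \<le> - M - int n" | "- M - int n \<le> i" "i \<le> M"
    by linarith
  then show ?thesis
  proof cases
    case 1
    then have "i - M \<ge> 0" by simp
    then obtain r m where i: "i - M = r + P * int m" "0 \<le> r" "r < P"
      using nonneg_int_decomp[OF P_pos] by metis
    have "x (i + int k) = x (M + r + int k)" for k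
    proof -
      have "i + int k = M + r + int k + P * int m" using i(1) by linarith
      moreover have "x (M + r + int k + P * int m) = x (M + r + int k)"
        using i(2) by (intro periodic_outside_right[OF out P_pos]) simp
      ultimately show ?thesis by (simp only:)
    qed
    then have "word x i n = word x (M + r) n" by (simp add: word_eq_iff)
    moreover have "M + r \<in> {- M - P - int n..M + P}" using i(2,3) M_nonneg P_pos by simp
    ultimately show ?thesis by blast
  next
    case 2
    then have "- M - int n - i \<ge> 0" by simp
    then obtain r m where i: "- M - int n - i = r + P * int m" "0 \<le> r" "r < P"
      using nonneg_int_decomp[OF P_pos] by metis
    have "x (i + int k) = x (- M - int n - r + int k)" if "k < n" for k
    proof -
      have "i + int k = - M - int n - r + int k - P * int m" using i(1) by linarith
      moreover have "x (- M - int n - r + int k - P * int m) = x (- M - int n - r + int k)"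
        using i(2) that by (intro periodic_outside_left[OF out P_pos]) simp
      ultimately show ?thesis by (simp only:)
    qed
    then have "word x i n = word x (- M - int n - r) n" by (simp add: word_eq_iff)
    moreover have "- M - int n - r \<in> {- M - P - int n..M + P}" using i(2,3) M_nonneg by simp
    ultimately show ?thesis by blast
  next
    case 3
    then show ?thesis using P_pos by (intro bexI[of _ i]) auto
  qed
qed

lemma lang_points_finite: "finite (lang points n)"
  and complexity_points_le: "complexity points n \<le> card R * nat (2 * M + 2 * P + int n + 1)"
proof -
  let ?W = "\<lambda>x. (\<lambda>j. word x j n) ` {- M - P - int n..M + P}"
  have sub: "lang points n \<subseteq> (\<Union>x\<in>R. ?W x)"
  proof
    fix w assume "w \<in> lang points n"
    then obtain x i where x: "x \<in> R" "w = word x i n"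
      unfolding lang_points by blast
    then obtain j where "j \<in> {- M - P - int n..M + P}" "w = word x j n"
      using word_near_origin[OF x(1), of n i] by metis
    then show "w \<in> (\<Union>x\<in>R. ?W x)"
      using x(1) by (intro UN_I[of x] image_eqI[of _ _ j])
  qed
  have fin: "finite (\<Union>x\<in>R. ?W x)" using finite_R by simp
  then show "finite (lang points n)" using sub finite_subset by blast
  have "card (?W x) \<le> nat (2 * M + 2 * P + int n + 1)" for x
    using card_image_le[of "{- M - P - int n..M + P}" "\<lambda>j. word x j n"] by (simp add: algebra_simps)
  then have "(\<Sum>x\<in>R. card (?W x)) \<le> card R * nat (2 * M + 2 * P + int n + 1)"
    using sum_bounded_above[of R "\<lambda>x. card (?W x)"] by simp
  moreover have "card (lang points n) \<le> (\<Sum>x\<in>R. card (?W x))"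
    using card_mono[OF fin sub] card_UN_le[OF finite_R, of ?W] by linarith
  ultimately show "complexity points n \<le> card R * nat (2 * M + 2 * P + int n + 1)"
    by (simp add: complexity_def)
qed

lemma finite_orbit:
  assumes "has_period P x"
  shows "finite (orbit x)"
proof -
  have "translate k x = translate (k mod P) x" for k
    using arg_cong[OF translate_has_period[OF assms, of "k div P"], of "translate (k mod P)"] by simp
  then have "orbit x \<subseteq> (\<lambda>k. translate k x) ` {0..<P}"
    using P_pos by (fastforce simp: orbit_eq_range_translate)
  then show ?thesis by (rule finite_subset) simp
qed

text \<open>
  An infinite union contains an orbit that is not \<open>P\<close>-periodic. Such an \<open>x\<close> has a last position
  \<open>d\<close> with \<open>x (d + P) \<noteq> x d\<close>, and a word of \<open>x\<close> that covers \<open>d\<close> and \<open>d + P\<close> reveals where \<open>d\<close>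
  lies inside it. Hence the \<open>n\<close> words of length \<open>n + P\<close> starting at \<open>d\<close>, ..., \<open>d - n + 1\<close> are
  distinct.
\<close>

lemma complexity_points_ge:
  assumes "infinite points"
  shows "n \<le> complexity points (n + nat P)"
proof -
  obtain x where x: "x \<in> R" "\<not> has_period P x"
  proof -
    have "finite points" if "\<And>x. x \<in> R \<Longrightarrow> has_period P x"
      unfolding points_def using finite_R that by (intro finite_UN_I finite_orbit)
    then show ?thesis using assms that by blast
  qed
  define D where "D = {i. x (i + P) \<noteq> x i}"
  have "D \<subseteq> {- M - P..M}"
  proof
    fix i assume i: "i \<in> D"
    have "x (j + P) = x j" if "j \<ge> M" for j
      using outside[OF x(1)] that by (simp add: periodic_outside_def)
    then have "\<not> i \<ge> M" using i by (auto simp: D_def)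
    have "x (j - P) = x j" if "j \<le> - M" for j
      using outside[OF x(1)] that by (simp add: periodic_outside_def)
    from this[of "i + P"] have "\<not> i + P \<le> - M" using i by (auto simp: D_def)
    with \<open>\<not> i \<ge> M\<close> show "i \<in> {- M - P..M}" by simp
  qed
  then have "finite D" by (rule finite_subset) simp
  moreover have "D \<noteq> {}" using x(2) by (auto simp: D_def has_period_def)
  ultimately have Max: "Max D \<in> D" "\<And>i. i \<in> D \<Longrightarrow> i \<le> Max D" by auto
  let ?w = "\<lambda>k. word x (Max D - int k) (n + nat P)"
  have differ: "?w k \<noteq> ?w l" if "k < l" "l < n" for k l
  proof
    assume eq: "?w k = ?w l"
    have "x (Max D - int k + int q) = x (Max D - int l + int q)" if "q < n + nat P" for q
      using eq that by (simp add: word_eq_iff)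
    from this[of l] this[of "l + nat P"]
    have "x (Max D - int k + int l) = x (Max D)" "x (Max D - int k + int l + P) = x (Max D + P)"
      using that P_pos by (simp_all add: algebra_simps)
    then have "Max D - int k + int l \<in> D" using Max(1) by (simp add: D_def)
    then show False using Max(2) \<open>k < l\<close> by force
  qed
  have "inj_on ?w {..<n}"
    unfolding inj_on_def by (metis differ lessThan_iff nat_neq_iff)
  then have "n = card (?w ` {..<n})" by (simp add: card_image)
  also have "\<dots> \<le> complexity points (n + nat P)"
    unfolding complexity_def using x(1)
    by (intro card_mono lang_points_finite) (auto simp: lang_points)
  finally show ?thesis .
qed

lemma linear_complexity_points: "linear_complexity points"
proof -
  have "complexity points n \<le> (card R * nat (2 * M + 2 * P + 2)) * n" if "n \<ge> 1" for n
  proof -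
    have "2 * M + 2 * P + int n + 1 \<le> (2 * M + 2 * P + 2) * int n"
    proof -
      have "(2 * M + 2 * P + 1) * 1 \<le> (2 * M + 2 * P + 1) * int n"
        using that M_nonneg P_pos by (intro mult_left_mono) auto
      then show ?thesis by (simp add: algebra_simps)
    qed
    then have "nat (2 * M + 2 * P + int n + 1) \<le> nat (2 * M + 2 * P + 2) * n"
      using M_nonneg P_pos by (metis nat_mono nat_int nat_mult_distrib add_nonneg_nonneg mult_nonneg_nonneg
          less_imp_le zero_le_numeral)
    then show ?thesis
      using complexity_points_le[of n] by (metis mult.assoc mult_le_mono2 order_trans)
  qed
  then have "real (complexity points n) \<le> real (card R * nat (2 * M + 2 * P + 2)) * real n"
    if "n \<ge> 1" for n
    using that by (metis of_nat_le_iff of_nat_mult)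
  then have O: "(\<lambda>n. real (complexity points n)) \<in> O(\<lambda>n. real n)"
    by (intro bigoI[of _ "real (card R * nat (2 * M + 2 * P + 2))"] eventually_sequentiallyI[of 1]) auto
  have "(\<lambda>n. real n) \<in> O(\<lambda>n. real (complexity points n))" if "infinite points"
  proof (intro bigoI[of _ 2] eventually_sequentiallyI[of "2 * nat P"])
    fix n assume n: "2 * nat P \<le> n"
    then have "n - nat P \<le> complexity points n"
      using complexity_points_ge[OF that, of "n - nat P"] by simp
    then have "n \<le> 2 * complexity points n" using n by linarith
    then show "norm (real n) \<le> 2 * norm (real (complexity points n))" by simp
  qed
  with O show ?thesis
    by (auto simp: linear_complexity_def bigtheta_def bigomega_iff_bigo)
qed

end

section \<open>Automorphism groups\<close>

lemma continuous_on_of_finite_windows: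
  fixes f :: "(int \<Rightarrow> int) \<Rightarrow> int \<Rightarrow> int"
  assumes "\<And>i. \<exists>b. \<forall>x\<in>X. \<forall>y\<in>X. (\<forall>j. \<bar>j\<bar> \<le> b \<longrightarrow> x j = y j) \<longrightarrow> f x i = f y i"
  shows "continuous_on X f"
proof (rule continuous_on_coordinatewise_then_product)
  fix i
  obtain b where b: "\<And>x y. x \<in> X \<Longrightarrow> y \<in> X \<Longrightarrow> (\<And>j. \<bar>j\<bar> \<le> b \<Longrightarrow> x j = y j) \<Longrightarrow> f x i = f y i"
    using assms[of i] by blast
  define W :: "(int \<Rightarrow> int) \<Rightarrow> (int \<Rightarrow> int) set" where "W x = (\<Inter>j\<in>{-b..b}. (\<lambda>y. y j) -` {x j})" for x
  have open_W: "open (W x)" for x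
    unfolding W_def by (intro open_INT ballI open_vimage continuous_on_product_coordinates) (auto simp: open_discrete)
  show "continuous_on X (\<lambda>x. f x i)"
    unfolding continuous_on_open_invariant
  proof (intro allI impI exI conjI)
    fix S :: "int set"
    let ?U = "\<Union>x\<in>{x \<in> X. f x i \<in> S}. W x"
    show "open ?U" using open_W by blast
    have "f y i \<in> S" if "y \<in> W x" "y \<in> X" "x \<in> X" "f x i \<in> S" for x y
    proof -
      have "x j = y j" if "\<bar>j\<bar> \<le> b" for j
        using that \<open>y \<in> W x\<close> by (simp add: W_def abs_le_iff)
      then show ?thesis using b[of x y] that by simp
    qed
    moreover have "y \<in> W y" for y by (simp add: W_def)
    ultimately show "?U \<inter> X = (\<lambda>x. f x i) -` S \<inter> X" by auto
  qed
qed

text \<open>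
  A function \<open>s\<close> with finitely many values whose fibres lie in cosets of \<open>H\<close> bounds the index of
  \<open>H\<close>.
\<close>

lemma (in group) finite_rcosets_of_signature:
  assumes H: "subgroup H G" and fin: "finite (s ` carrier G)"
    and eq: "\<And>f g. f \<in> carrier G \<Longrightarrow> g \<in> carrier G \<Longrightarrow> s f = s g \<Longrightarrow> f \<otimes> inv g \<in> H"
  shows "finite (rcosets H)"
proof -
  have coset_eq: "H #> f = H #> g" if "f \<in> carrier G" "g \<in> carrier G" "s f = s g" for f g
  proof -
    have "f = (f \<otimes> inv g) \<otimes> g" using that by (simp add: m_assoc)
    then have "f \<in> H #> g" using eq[OF that] by (auto simp: r_coset_def)
    then show ?thesis using repr_independence[OF _ that(2) H] by simp
  qed
  have "rcosets H \<subseteq> (\<lambda>t. H #> inv_into (carrier G) s t) ` s ` carrier G"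
  proof
    fix C assume "C \<in> rcosets H"
    then obtain f where f: "f \<in> carrier G" "C = H #> f" by (auto simp: RCOSETS_def)
    have "inv_into (carrier G) s (s f) \<in> carrier G" "s (inv_into (carrier G) s (s f)) = s f"
      using f by (auto intro: inv_into_into f_inv_into_f)
    then have "C = H #> inv_into (carrier G) s (s f)" using coset_eq f by metis
    then show "C \<in> (\<lambda>t. H #> inv_into (carrier G) s t) ` s ` carrier G" using f(1) by blast
  qed
  then show ?thesis using fin finite_subset by blast
qed

lemma Aut_carrier_iff:
  "f \<in> carrier (Aut X) \<longleftrightarrow>
     f \<in> Bij X \<and> (\<exists>g. homeomorphism X X f g) \<and> (\<forall>x\<in>X. f (shift x) = shift (f x))"
  by (simp add: Aut_def)

lemma Aut_mult: "f \<in> carrier (Aut X) \<Longrightarrow> g \<in> carrier (Aut X) \<Longrightarrow> f \<otimes>\<^bsub>Aut X\<^esub> g = compose X f g"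
  by (simp add: Aut_def BijGroup_def)

lemma Aut_one: "\<one>\<^bsub>Aut X\<^esub> = (\<lambda>x\<in>X. x)"
  by (simp add: Aut_def BijGroup_def)

lemma Aut_in: "f \<in> carrier (Aut X) \<Longrightarrow> x \<in> X \<Longrightarrow> f x \<in> X"
  by (auto simp: Aut_carrier_iff Bij_def bij_betw_def)

lemma Aut_eqI:
  "f \<in> carrier (Aut X) \<Longrightarrow> g \<in> carrier (Aut X) \<Longrightarrow> (\<And>x. x \<in> X \<Longrightarrow> f x = g x) \<Longrightarrow> f = g"
  by (auto simp: Aut_carrier_iff Bij_def intro: extensionalityI)

lemma Aut_translate:
  assumes f: "f \<in> carrier (Aut X)" and X: "\<And>k x. x \<in> X \<Longrightarrow> translate k x \<in> X" and x: "x \<in> X"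
  shows "f (translate k x) = translate k (f x)"
proof -
  have nat: "f (translate (int n) y) = translate (int n) (f y)" if "y \<in> X" for n y
  proof (induction n)
    case (Suc n)
    have "f (translate (int (Suc n)) y) = f (shift (translate (int n) y))"
      by (simp add: shift_eq_translate)
    also have "\<dots> = shift (f (translate (int n) y))"
      using f X[OF that] by (simp add: Aut_carrier_iff)
    finally show ?case using Suc by (simp add: shift_eq_translate)
  qed simp
  show ?thesis
  proof (cases k rule: int_cases2)
    case (nonneg n)
    then show ?thesis using nat x by simp
  next
    case (nonpos n)
    have "f x = translate (int n) (f (translate k x))"
      using nat[OF X[OF x, of k], of n] nonpos by simp
    then show ?thesis using nonpos by simp
  qed
qed

context eventually_periodic_family
begin

lemma Aut_points_translate:
  "f \<in> carrier (Aut points) \<Longrightarrow> y \<in> points \<Longrightarrow> f (translate k y) = translate k (f y)"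
  by (rule Aut_translate) (simp_all add: translate_in_points)

lemma defect_outside:
  assumes "y \<in> points" "y (i + P) \<noteq> y i"
  shows "periodic_outside P (2 * M + P) (translate i y)"
proof -
  obtain x k where x: "x \<in> R" "y = translate k x" using assms(1) by (rule pointsE)
  note out = outside[OF x(1)]
  have R: "x (j + P) = x j" if "j \<ge> M" for j
    using out that by (simp add: periodic_outside_def)
  have L: "x (j - P) = x j" if "j \<le> - M" for j
    using out that by (simp add: periodic_outside_def)
  have ne: "x (i + k + P) \<noteq> x (i + k)"
    using assms(2) by (simp add: x(2) translate_def algebra_simps)
  have ik: "i + k < M" "i + k + P > - M"
    using ne R[of "i + k"] L[of "i + k + P"] by force+
  show ?thesis
    unfolding periodic_outside_def
  proof (intro conjI allI impI)
    fix j assume "j \<ge> 2 * M + P"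
    then have "x (j + i + k + P) = x (j + i + k)" using R ik by simp
    then show "translate i y (j + P) = translate i y j"
      by (simp add: x(2) translate_def algebra_simps)
  next
    fix j assume "j \<le> - (2 * M + P)"
    then have "x (j + i + k - P) = x (j + i + k)" using L ik P_pos by simp
    then show "translate i y (j - P) = translate i y j"
      by (simp add: x(2) translate_def algebra_simps)
  qed
qed

text \<open>
  A position \<open>j\<close> with \<open>y (j + P) \<noteq> y j\<close> (a defect) determines the rest of \<open>y\<close>: by
  \<open>defect_outside\<close> the sequence is periodic at bounded distance from \<open>j\<close>. So two points that
  agree on a long window are equal or have no defect in its middle part.
\<close>

lemma eq_or_no_defects:
  assumes y: "y \<in> points" "y' \<in> points" and agree: "\<And>j. \<bar>j\<bar> \<le> c + 2 * M + 2 * P \<Longrightarrow> y j = y' j"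
    and ne: "y \<noteq> y'" and j: "\<bar>j\<bar> \<le> c"
  shows "y (j + P) = y j"
proof (rule ccontr)
  assume defect: "y (j + P) \<noteq> y j"
  have "y' (j + P) \<noteq> y' j"
    using defect agree[of j] agree[of "j + P"] j M_nonneg P_pos by auto
  then have "translate j y = translate j y'"
    using defect j M_nonneg P_pos
    by (intro periodic_outside_eqI[OF defect_outside[OF y(1) defect] defect_outside[OF y(2)] P_pos])
      (auto simp: translate_def intro!: agree)
  then have "translate (- j) (translate j y) = translate (- j) (translate j y')" by simp
  then show False using ne by simp
qed

lemma no_defects_translate:
  assumes "\<And>j. \<bar>j\<bar> \<le> c \<Longrightarrow> y (j + P) = y j" "\<bar>i\<bar> + P * \<bar>k\<bar> \<le> c"
  shows "y (i + P * k) = y i"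
proof -
  have nat: "y (a + P * int n) = y a" if "- c \<le> a" "a + P * int n \<le> c" for a n
    using that
  proof (induction n)
    case (Suc n)
    have step: "a + P * int (Suc n) = a + P * int n + P" by (simp add: algebra_simps)
    have "0 \<le> P * int n" using P_pos by simp
    then have "\<bar>a + P * int n\<bar> \<le> c" and "a + P * int n \<le> c"
      using Suc.prems step P_pos by linarith+
    then have "y (a + P * int n + P) = y a" using assms(1) Suc.IH Suc.prems(1) by simp
    then show ?case unfolding step by (simp only: add.assoc)
  qed simp
  show ?thesis
  proof (cases k rule: int_cases2)
    case (nonneg n)
    moreover have "0 \<le> P * int n" using P_pos by simp
    ultimately have "- c \<le> i" "i + P * int n \<le> c" using assms(2) by simp_all
    then show ?thesis using nat[of i n] nonneg by simp
  next
    case (nonpos n)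
    moreover have "0 \<le> P * int n" using P_pos by simp
    ultimately have "- c \<le> i + P * k" "i + P * k + P * int n \<le> c" using assms(2) by simp_all
    then show ?thesis using nat[of "i + P * k" n] nonpos by simp
  qed
qed

definition aperiodic_orbits :: "(int \<Rightarrow> int) set set" where
  "aperiodic_orbits = orbit ` {x \<in> R. \<not> has_period P x}"

text \<open>
  The orbits that are not \<open>P\<close>-periodic are enumerated by \<open>h\<close> on \<open>{..<r}\<close>, and the \<open>i\<close>-th one is
  translated by \<open>P * c i\<close>. On a \<open>P\<close>-periodic point the index is arbitrary, but the translation
  amount is a multiple of \<open>P\<close> and the point is fixed.
\<close>

definition orbitwise_translation ::
    "(nat \<Rightarrow> (int \<Rightarrow> int) set) \<Rightarrow> nat \<Rightarrow> (nat \<Rightarrow> int) \<Rightarrow> (int \<Rightarrow> int) \<Rightarrow> int \<Rightarrow> int" where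
  "orbitwise_translation h r c = (\<lambda>y\<in>points. translate (P * c (inv_into {..<r} h (orbit y))) y)"

text \<open>
  The finite-index subgroup: the automorphisms that preserve every orbit of the \<open>P\<close>-th power of
  the shift.
\<close>

definition orbitwise_translations :: "((int \<Rightarrow> int) \<Rightarrow> (int \<Rightarrow> int)) set" where
  "orbitwise_translations =
     {f \<in> carrier (Aut points). \<forall>x\<in>points. \<exists>k. f x = translate (P * k) x}"

lemma orbit_of_aperiodic_point:
  assumes "y \<in> points" "\<not> has_period P y"
  shows "orbit y \<in> aperiodic_orbits"
proof -
  obtain x k where x: "x \<in> R" "y = translate k x" using assms(1) by (rule pointsE)
  have "\<not> has_period P x"
  proof
    assume "has_period P x"
    then have "translate k (translate P x) = translate k x" by (simp add: has_period_iff_translate)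
    then have "has_period P y" by (simp add: x(2) has_period_iff_translate add.commute)
    then show False using assms(2) by blast
  qed
  then show ?thesis using x by (auto simp: aperiodic_orbits_def orbit_translate)
qed

context
  fixes h r
  assumes h: "bij_betw h {..<r::nat} aperiodic_orbits"
begin

abbreviation "F \<equiv> orbitwise_translation h r"
abbreviation "idx y \<equiv> inv_into {..<r} h (orbit y)"

lemma orbitwise_translation_apply: "y \<in> points \<Longrightarrow> F c y = translate (P * c (idx y)) y"
  by (simp add: orbitwise_translation_def)

lemma idx_less:
  assumes "y \<in> points" "\<not> has_period P y"
  shows "idx y < r"
  using orbit_of_aperiodic_point[OF assms] h bij_betw_imp_surj_on inv_into_into lessThan_iff by metis

lemma orbitwise_translation_cong: "(\<And>i. i < r \<Longrightarrow> c i = d i) \<Longrightarrow> F c = F d"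
  unfolding orbitwise_translation_def
proof (rule restrict_ext)
  fix y assume eq: "\<And>i. i < r \<Longrightarrow> c i = d i" and y: "y \<in> points"
  show "translate (P * c (idx y)) y = translate (P * d (idx y)) y"
    by (cases "has_period P y") (simp_all add: translate_has_period eq idx_less[OF y])
qed

lemma orbitwise_translation_comp:
  assumes "y \<in> points"
  shows "F c (F d y) = F (\<lambda>i. c i + d i) y"
  using assms by (simp add: orbitwise_translation_apply translate_in_points orbit_translate algebra_simps)

text \<open>
  The coordinate \<open>i\<close> of \<open>F c y\<close> is determined by a window of \<open>y\<close>. If the window has no
  defects, then translating by a bounded multiple of \<open>P\<close> does not change the coordinate; if it
  has one, then the window determines \<open>y\<close>.
\<close>

lemma continuous_orbitwise_translation: "continuous_on points (F c)"
proof (rule continuous_on_of_finite_windows)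
  fix i :: int
  define C where "C = \<bar>i\<bar> + P * (\<Sum>j<r. \<bar>c j\<bar>)"
  have F_eq: "F c y i = y i" if y: "y \<in> points" and no: "\<And>j. \<bar>j\<bar> \<le> C \<Longrightarrow> y (j + P) = y j" for y
  proof (cases "has_period P y")
    case True
    then show ?thesis using y by (simp add: orbitwise_translation_apply translate_has_period)
  next
    case False
    have "\<bar>c (idx y)\<bar> \<le> (\<Sum>j<r. \<bar>c j\<bar>)"
      using idx_less[OF y False] member_le_sum[of "idx y" "{..<r}" "\<lambda>j. \<bar>c j\<bar>"] by simp
    then have "\<bar>i\<bar> + P * \<bar>c (idx y)\<bar> \<le> C"
      using P_pos by (simp add: C_def mult_left_mono)
    then show ?thesis
      using no_defects_translate[of C y i "c (idx y)"] no y by (simp add: orbitwise_translation_apply translate_def)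
  qed
  have C: "C \<ge> \<bar>i\<bar>" using P_pos by (simp add: C_def sum_nonneg)
  show "\<exists>b. \<forall>y\<in>points. \<forall>y'\<in>points. (\<forall>j. \<bar>j\<bar> \<le> b \<longrightarrow> y j = y' j) \<longrightarrow> F c y i = F c y' i"
  proof (intro exI ballI impI)
    fix y y' assume y: "y \<in> points" "y' \<in> points"
      and agree: "\<forall>j. \<bar>j\<bar> \<le> C + 2 * M + 2 * P \<longrightarrow> y j = y' j"
    show "F c y i = F c y' i"
    proof (cases "y = y'")
      case False
      have "y (j + P) = y j" if "\<bar>j\<bar> \<le> C" for j
        by (rule eq_or_no_defects[OF y _ False that]) (use agree in blast)
      moreover have "y' (j + P) = y' j" if "\<bar>j\<bar> \<le> C" for j
        by (rule eq_or_no_defects[OF y(2,1) _ False[symmetric] that]) (use agree in simp)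
      ultimately have "F c y i = y i" "F c y' i = y' i"
        using F_eq y by simp_all
      then show ?thesis using agree C M_nonneg P_pos by simp
    qed simp
  qed
qed

lemma orbitwise_translation_in: "F c \<in> orbitwise_translations"
proof -
  have inv: "F (\<lambda>i. - c i) (F c y) = y" "F c (F (\<lambda>i. - c i) y) = y" if "y \<in> points" for y
    using that by (simp_all add: orbitwise_translation_comp) (simp_all add: orbitwise_translation_apply)
  have in_points: "F d y \<in> points" if "y \<in> points" for d y
    using that by (simp add: orbitwise_translation_apply translate_in_points)
  have hom: "homeomorphism points points (F c) (F (\<lambda>i. - c i))"
    using inv in_points continuous_orbitwise_translation by (intro homeomorphismI) auto
  then have "bij_betw (F c) points points"
    using inv in_points by (intro bij_betw_byWitness[where f' = "F (\<lambda>i. - c i)"]) auto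
  then have "F c \<in> Bij points" by (simp add: Bij_def orbitwise_translation_def)
  moreover have "F c (shift y) = shift (F c y)" if "y \<in> points" for y
    using that by (simp add: shift_eq_translate orbitwise_translation_apply translate_in_points orbit_translate add.commute)
  ultimately have "F c \<in> carrier (Aut points)"
    using hom unfolding Aut_carrier_iff by blast
  moreover have "\<exists>k. F c y = translate (P * k) y" if "y \<in> points" for y
    using orbitwise_translation_apply[OF that] by blast
  ultimately show ?thesis
    by (simp add: orbitwise_translations_def)
qed

text \<open>
  A representative \<open>e i\<close> of the \<open>i\<close>-th aperiodic orbit has a free orbit, so its image determines
  \<open>c i\<close>. Conversely, an orbitwise translation fixes the \<open>P\<close>-periodic points and, as it commutes
  with the shift, is determined by the images of the representatives.
\<close>

lemma bij_orbitwise_translation: "bij_betw F (\<Pi>\<^sub>E i\<in>{..<r}. UNIV) orbitwise_translations"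
  unfolding bij_betw_def
proof
  have "\<exists>x. x \<in> R \<and> \<not> has_period P x \<and> orbit x = h i" if "i < r" for i
  proof -
    have "h i \<in> aperiodic_orbits" using h that by (meson bij_betwE lessThan_iff)
    then obtain x where "x \<in> {x \<in> R. \<not> has_period P x}" "h i = orbit x"
      unfolding aperiodic_orbits_def by (rule imageE)
    then show ?thesis by (intro exI[of _ x]) simp
  qed
  then obtain e where e: "\<And>i. i < r \<Longrightarrow> e i \<in> R \<and> \<not> has_period P (e i) \<and> orbit (e i) = h i" by metis
  have idx_e: "idx (e i) = i" if "i < r" for i
    using e[OF that] h that by (simp add: bij_betw_inv_into_left)
  have F_e: "F c (e i) = translate (P * c i) (e i)" if "i < r" for c i
    using orbitwise_translation_apply[of "e i" c] e[OF that] R_subset_points unfolding idx_e[OF that] by blast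
  show "inj_on F (\<Pi>\<^sub>E i\<in>{..<r}. UNIV)"
  proof (rule inj_onI)
    fix c d :: "nat \<Rightarrow> int" assume c: "c \<in> (\<Pi>\<^sub>E i\<in>{..<r}. UNIV)" and d: "d \<in> (\<Pi>\<^sub>E i\<in>{..<r}. UNIV)"
      and eq: "F c = F d"
    have "c i = d i" if i: "i < r" for i
    proof (rule ccontr)
      assume ne: "c i \<noteq> d i"
      have "translate (P * c i) (e i) = translate (P * d i) (e i)"
        using fun_cong[OF eq, of "e i"] F_e[OF i] by simp
      moreover have "P * c i \<noteq> P * d i" using ne P_pos by simp
      ultimately have "has_period P (e i)"
        using e[OF i] period_of_translate_eq[OF outside P_pos] by blast
      then show False using e[OF i] by blast
    qed
    then show "c = d" using c d by (intro PiE_ext) auto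
  qed
  show "F ` (\<Pi>\<^sub>E i\<in>{..<r}. UNIV) = orbitwise_translations"
  proof (intro equalityI subsetI)
    fix f assume f: "f \<in> orbitwise_translations"
    then have fA: "f \<in> carrier (Aut points)" and ex: "\<And>x. x \<in> points \<Longrightarrow> \<exists>k. f x = translate (P * k) x"
      by (auto simp: orbitwise_translations_def)
    have "\<exists>k. f (e i) = translate (P * k) (e i)" if "i < r" for i
      using ex e[OF that] R_subset_points by blast
    then obtain c where c: "\<And>i. i < r \<Longrightarrow> f (e i) = translate (P * c i) (e i)" by metis
    have "F (\<lambda>i\<in>{..<r}. c i) = F c" by (rule orbitwise_translation_cong) simp
    moreover have "f = F c"
    proof (rule Aut_eqI[OF fA])
      show "F c \<in> carrier (Aut points)"
        using orbitwise_translation_in by (auto simp: orbitwise_translations_def)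
      fix y assume y: "y \<in> points"
      show "f y = F c y"
      proof (cases "has_period P y")
        case True
        then show ?thesis using ex[OF y] y by (auto simp: orbitwise_translation_apply translate_has_period)
      next
        case False
        have i: "idx y < r" using idx_less[OF y False] .
        have "h (idx y) = orbit y"
          using orbit_of_aperiodic_point[OF y False] h by (simp add: bij_betw_inv_into_right)
        then have "y \<in> orbit (e (idx y))"
          using e[OF i] translate_in_orbit[of 0 y] by simp
        then obtain k where k: "y = translate k (e (idx y))"
          by (auto simp: orbit_eq_range_translate)
        have "e (idx y) \<in> points" using e[OF i] R_subset_points by blast
        then have "f (translate k (e (idx y))) = translate k (f (e (idx y)))"
          by (rule Aut_points_translate[OF fA])
        then have "f y = translate k (f (e (idx y)))" unfolding k[symmetric] .
        also have "\<dots> = translate (P * c (idx y)) y"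
          using arg_cong[OF k, of "translate (P * c (idx y))"] by (simp add: c[OF i] add.commute)
        finally show ?thesis using y by (simp add: orbitwise_translation_apply)
      qed
    qed
    ultimately show "f \<in> F ` (\<Pi>\<^sub>E i\<in>{..<r}. UNIV)"
      by (intro image_eqI[of _ _ "\<lambda>i\<in>{..<r}. c i"]) auto
  qed (use orbitwise_translation_in in auto)
qed

lemma orbitwise_translation_iso:
  "F \<in> iso (product_group {..<r} (\<lambda>_. integer_group)) ((Aut points)\<lparr>carrier := orbitwise_translations\<rparr>)"
proof -
  have "F (\<lambda>i\<in>{..<r}. c i + d i) = F c \<otimes>\<^bsub>Aut points\<^esub> F d" for c d
  proof -
    have A: "F c \<in> carrier (Aut points)" for c
      using orbitwise_translation_in by (auto simp: orbitwise_translations_def)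
    have "F (\<lambda>i\<in>{..<r}. c i + d i) = F (\<lambda>i. c i + d i)" by (rule orbitwise_translation_cong) simp
    also have "\<dots> = compose points (F c) (F d)"
      using orbitwise_translation_comp by (intro extensionalityI[of _ points])
        (auto simp: orbitwise_translation_def[of h r "\<lambda>i. c i + d i"] compose_def)
    finally show ?thesis using A by (simp add: Aut_mult)
  qed
  then show ?thesis
    using bij_orbitwise_translation orbitwise_translation_in by (auto simp: iso_def hom_def integer_group_def)
qed

end

lemma subgroup_orbitwise_translations:
  assumes "subshift points"
  shows "subgroup orbitwise_translations (Aut points)"
proof -
  interpret A: group "Aut points" using assms by (rule group_Aut)
  show ?thesis
  proof (rule A.subgroupI)
    show "orbitwise_translations \<subseteq> carrier (Aut points)" by (auto simp: orbitwise_translations_def)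
    have "\<exists>k. \<one>\<^bsub>Aut points\<^esub> x = translate (P * k) x" if "x \<in> points" for x
      using that by (intro exI[of _ 0]) (simp add: Aut_one)
    then have "\<one>\<^bsub>Aut points\<^esub> \<in> orbitwise_translations"
      by (simp add: orbitwise_translations_def)
    then show "orbitwise_translations \<noteq> {}" by blast
  next
    fix f assume f: "f \<in> orbitwise_translations"
    then have fA: "f \<in> carrier (Aut points)" by (simp add: orbitwise_translations_def)
    let ?g = "inv\<^bsub>Aut points\<^esub> f"
    have gA: "?g \<in> carrier (Aut points)" using fA by simp
    have "\<exists>k. ?g x = translate (P * k) x" if x: "x \<in> points" for x
    proof -
      have "compose points f ?g = (\<lambda>x\<in>points. x)"
        using A.r_inv[OF fA] fA gA by (simp add: Aut_mult Aut_one)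
      then have "f (?g x) = x" using x by (metis compose_eq restrict_apply')
      moreover obtain k where "f (?g x) = translate (P * k) (?g x)"
        using f Aut_in[OF gA x] by (auto simp: orbitwise_translations_def)
      ultimately have "translate (P * - k) x = translate (P * - k) (translate (P * k) (?g x))" by simp
      then show ?thesis by (intro exI[of _ "-k"]) simp
    qed
    then show "?g \<in> orbitwise_translations" using gA by (simp add: orbitwise_translations_def)
  next
    fix f g assume f: "f \<in> orbitwise_translations" and g: "g \<in> orbitwise_translations"
    then have A: "f \<in> carrier (Aut points)" "g \<in> carrier (Aut points)"
      by (simp_all add: orbitwise_translations_def)
    have "\<exists>k. (f \<otimes>\<^bsub>Aut points\<^esub> g) x = translate (P * k) x" if x: "x \<in> points" for x
    proof -
      obtain k where k: "g x = translate (P * k) x"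
        using g x by (auto simp: orbitwise_translations_def)
      obtain l where l: "f (g x) = translate (P * l) (g x)"
        using f Aut_in[OF A(2) x] by (auto simp: orbitwise_translations_def)
      show ?thesis
        using k l x A by (intro exI[of _ "l + k"]) (simp add: Aut_mult compose_eq algebra_simps)
    qed
    then show "f \<otimes>\<^bsub>Aut points\<^esub> g \<in> orbitwise_translations"
      using A by (simp add: orbitwise_translations_def)
  qed
qed

text \<open>
  The \<open>P\<close>-th power of the shift has finitely many orbits. The signature of \<open>f\<close> records for each
  \<open>x \<in> R\<close> the one that contains \<open>f x\<close>.
\<close>

lemma finite_index_orbitwise_translations:
  assumes "subshift points"
  shows "finite (rcosets\<^bsub>Aut points\<^esub> orbitwise_translations)"
proof -
  interpret A: group "Aut points" using assms by (rule group_Aut)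
  define cls :: "(int \<Rightarrow> int) \<Rightarrow> (int \<Rightarrow> int) set" where "cls y = range (\<lambda>k. translate (P * k) y)" for y
  have cls_eq: "\<exists>k. y = translate (P * k) z" if "cls y = cls z" for y z
    using that rangeI[of "\<lambda>k. translate (P * k) y" 0] by (auto simp: cls_def)
  have cls_translate: "cls (translate (P * k) y) = cls y" for k y
  proof -
    have "translate (P * l) y \<in> range (\<lambda>l. translate (P * l) (translate (P * k) y))" for l
      by (rule range_eqI[of _ _ "l - k"]) (simp add: algebra_simps)
    moreover have "translate (P * l) (translate (P * k) y) \<in> range (\<lambda>l. translate (P * l) y)" for l
      by (rule range_eqI[of _ _ "l + k"]) (simp add: algebra_simps)
    ultimately show ?thesis by (auto simp: cls_def)
  qed
  have "cls ` points \<subseteq> (\<lambda>(x, s). cls (translate s x)) ` (R \<times> {0..<P})"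
  proof
    fix Q assume "Q \<in> cls ` points"
    then obtain x k where x: "x \<in> R" "Q = cls (translate k x)" by (auto elim: pointsE)
    have "translate k x = translate (P * (k div P)) (translate (k mod P) x)" by simp
    then have "Q = cls (translate (k mod P) x)" using x(2) cls_translate by metis
    then show "Q \<in> (\<lambda>(x, s). cls (translate s x)) ` (R \<times> {0..<P})"
      using x(1) P_pos by (intro image_eqI[of _ _ "(x, k mod P)"]) auto
  qed
  then have finite_cls: "finite (cls ` points)" by (rule finite_subset) (simp add: finite_R)
  show ?thesis
  proof (rule A.finite_rcosets_of_signature[OF subgroup_orbitwise_translations[OF assms]])
    let ?s = "\<lambda>f. \<lambda>x\<in>R. cls (f x)"
    have "?s ` carrier (Aut points) \<subseteq> (\<Pi>\<^sub>E x\<in>R. cls ` points)"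
      using Aut_in R_subset_points by auto
    then show "finite (?s ` carrier (Aut points))"
      using finite_PiE[OF finite_R finite_cls] finite_subset by blast
    fix f g assume f: "f \<in> carrier (Aut points)" and g: "g \<in> carrier (Aut points)" and eq: "?s f = ?s g"
    have fg: "\<exists>k. f y = translate (P * k) (g y)" if "y \<in> points" for y
    proof -
      from that obtain x l where x: "x \<in> R" "y = translate l x" by (rule pointsE)
      have "cls (f x) = cls (g x)" using fun_cong[OF eq, of x] x(1) by simp
      then obtain k where "f x = translate (P * k) (g x)" using cls_eq by blast
      moreover have "f y = translate l (f x)" "g y = translate l (g x)"
        using x(2) Aut_points_translate[OF f] Aut_points_translate[OF g] R_subset_points[OF x(1)] by simp_all
      ultimately show ?thesis by (intro exI[of _ k]) (simp add: add.commute)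
    qed
    let ?g = "inv\<^bsub>Aut points\<^esub> g"
    have gA: "?g \<in> carrier (Aut points)" using g by simp
    have "\<exists>k. (f \<otimes>\<^bsub>Aut points\<^esub> ?g) y = translate (P * k) y" if y: "y \<in> points" for y
    proof -
      have "compose points g ?g = (\<lambda>x\<in>points. x)"
        using A.r_inv[OF g] g gA by (simp add: Aut_mult Aut_one)
      then have "g (?g y) = y" using y by (metis compose_eq restrict_apply')
      then show ?thesis
        using fg[OF Aut_in[OF gA y]] y f gA by (simp add: Aut_mult compose_eq)
    qed
    then show "f \<otimes>\<^bsub>Aut points\<^esub> ?g \<in> orbitwise_translations"
      using f gA by (simp add: orbitwise_translations_def)
  qed
qed

lemma virtually_free_abelian_Aut_points:
  assumes "subshift points"
  shows "virtually_free_abelian_of_finite_rank (Aut points)"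
proof -
  have "finite aperiodic_orbits" using finite_R by (simp add: aperiodic_orbits_def)
  then obtain h where "bij_betw h {0..<card aperiodic_orbits} aperiodic_orbits"
    using ex_bij_betw_nat_finite by blast
  then have h: "bij_betw h {..<card aperiodic_orbits} aperiodic_orbits"
    by (simp add: lessThan_atLeast0)
  have "product_group {..<card aperiodic_orbits} (\<lambda>_. integer_group)
      \<cong> (Aut points)\<lparr>carrier := orbitwise_translations\<rparr>"
    using orbitwise_translation_iso[OF h] unfolding is_iso_def by (metis empty_iff)
  then have "(Aut points)\<lparr>carrier := orbitwise_translations\<rparr>
      \<cong> product_group {..<card aperiodic_orbits} (\<lambda>_. integer_group)"
    by (rule group.iso_sym[rotated]) (rule product_group, rule group_integer_group)
  then show ?thesis
    unfolding virtually_free_abelian_of_finite_rank_def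
    using subgroup_orbitwise_translations[OF assms] finite_index_orbitwise_translations[OF assms]
    by blast
qed

end

section \<open>Isolated subshifts of finite type\<close>

lemma closed_words_in:
  assumes "finite L"
  shows "closed {x :: int \<Rightarrow> int. word x i m \<in> L}"
proof -
  have "{x :: int \<Rightarrow> int. word x i m \<in> L} = (\<Union>w\<in>{w \<in> L. length w = m}. \<Inter>k\<in>{..<m}. (\<lambda>x. x (i + int k)) -` {w ! k})"
  proof (intro equalityI subsetI)
    fix x assume "x \<in> {x :: int \<Rightarrow> int. word x i m \<in> L}"
    then show "x \<in> (\<Union>w\<in>{w \<in> L. length w = m}. \<Inter>k\<in>{..<m}. (\<lambda>x. x (i + int k)) -` {w ! k})"
      by (intro UN_I[of "word x i m"]) auto
  next
    fix x :: "int \<Rightarrow> int" assume "x \<in> (\<Union>w\<in>{w \<in> L. length w = m}. \<Inter>k\<in>{..<m}. (\<lambda>x. x (i + int k)) -` {w ! k})"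
    then obtain w where "w \<in> L" "length w = m" "\<forall>k<m. x (i + int k) = w ! k" by auto
    moreover from this have "word x i m = w" by (intro nth_equalityI) auto
    ultimately show "x \<in> {x. word x i m \<in> L}" by simp
  qed
  moreover have "closed ((\<lambda>x :: int \<Rightarrow> int. x (i + int k)) -` {a})" for k a
    by (intro closed_vimage continuous_on_product_coordinates) simp
  ultimately show ?thesis
    using assms by (auto intro!: closed_UN closed_INT)
qed

lemma compact_sequences_over_finite:
  assumes "finite A"
  shows "compact {x :: int \<Rightarrow> int. range x \<subseteq> A}"
proof -
  have "compactin (product_topology (\<lambda>_::int. euclidean :: int topology) UNIV) (PiE UNIV (\<lambda>_. A))"
    unfolding compactin_PiE using assms finite_imp_compact by auto
  moreover have "PiE UNIV (\<lambda>_. A) = {x :: int \<Rightarrow> int. range x \<subseteq> A}"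
    by (auto simp: PiE_def)
  ultimately show ?thesis
    by (simp add: euclidean_product_topology)
qed

text \<open>A word of a periodic end is a word of every sequence having this end.\<close>

lemma word_of_right_end:
  assumes "has_period p z" "p > 0" "\<And>i. i \<ge> m \<Longrightarrow> z i = x i"
  obtains j where "word z i n = word x j n"
proof
  let ?t = "\<bar>i\<bar> + \<bar>m\<bar>"
  have "p * ?t \<ge> ?t" using mult_right_mono[of 1 p ?t] assms(2) by simp
  then have "i + p * ?t \<ge> m" by linarith
  then have "x (i + p * ?t + int k) = z (i + int k)" for k
    using assms(3)[of "i + p * ?t + int k"] has_period_mult[OF assms(1), of "i + int k" ?t]
    by (simp add: algebra_simps)
  then show "word z i n = word x (i + p * ?t) n" by (simp add: word_eq_iff)
qed

lemma word_of_left_end: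
  assumes "has_period p z" "p > 0" "\<And>i. i \<le> m \<Longrightarrow> z i = x i"
  obtains j where "word z i n = word x j n"
proof
  let ?t = "\<bar>i\<bar> + \<bar>m\<bar> + int n"
  have "p * ?t \<ge> ?t" using mult_right_mono[of 1 p ?t] assms(2) by simp
  then have "i - p * ?t + int n \<le> m" by linarith
  then have "x (i - p * ?t + int k) = z (i + int k)" if "k < n" for k
    using assms(3)[of "i - p * ?t + int k"] has_period_mult[OF assms(1), of "i + int k" "- ?t"] that
    by (simp add: algebra_simps)
  then show "word z i n = word x (i - p * ?t) n" by (simp add: word_eq_iff)
qed

text \<open>
  The last assumption says that the right end of an aperiodic member is never continued like the
  left end of an aperiodic member. It is stated for words of length \<open>n\<close>, since these are the
  vertices of the graph from which such families are built. Since \<open>n\<close> is at most \<open>M\<close>, the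
  constants below depend on \<open>M\<close> and \<open>P\<close> alone.
\<close>

locale separated_family = eventually_periodic_family +
  fixes n :: nat
  assumes n_le: "int n \<le> M" and nonempty: "R \<noteq> {}"
    and right_end: "\<And>x. x \<in> R \<Longrightarrow> \<exists>z\<in>R. has_period P z \<and> (\<forall>i\<ge>M. z i = x i)"
    and left_end: "\<And>x. x \<in> R \<Longrightarrow> \<exists>z\<in>R. has_period P z \<and> (\<forall>i\<le>-M. z i = x i)"
    and separated: "\<And>x x' i j. x \<in> R \<Longrightarrow> x' \<in> R \<Longrightarrow> \<not> has_period P x \<Longrightarrow> \<not> has_period P x' \<Longrightarrow>
      i \<ge> M \<Longrightarrow> j \<le> -M \<Longrightarrow> word x i n \<noteq> word x' j n"
begin

text \<open>
  A defect of a member lies strictly between \<open>-M - P\<close> and \<open>M\<close>. The radius is so large that, if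
  another defect occurs outside the window around a defect, then some word of length \<open>n\<close> near the
  new defect lies in a tail of both members involved (see \<open>agree_right\<close>).
\<close>

definition radius :: int where "radius = 5 * M + 3 * P"

definition window :: nat where "window = nat (2 * radius + 1)"

definition locally_in_points :: "(int \<Rightarrow> int) \<Rightarrow> bool" where
  "locally_in_points y \<longleftrightarrow> (\<forall>i. \<exists>x\<in>R. \<exists>k. \<forall>l. \<bar>l\<bar> \<le> radius \<longrightarrow> y (i + l) = x (k + l))"

lemma defect_range:
  assumes "x \<in> R" "x (i + P) \<noteq> x i"
  shows "- M - P < i" "i < M"
proof -
  have "x (j + P) = x j" if "j \<ge> M" for j
    using outside[OF assms(1)] that by (simp add: periodic_outside_def)
  from this[of i] show "i < M" using assms(2) by force
  have "x (j - P) = x j" if "j \<le> - M" for j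
    using outside[OF assms(1)] that by (simp add: periodic_outside_def)
  from this[of "i + P"] show "- M - P < i" using assms(2) by force
qed

lemma window_eq_iff:
  "word y (i - radius) window = word x (j - radius) window \<longleftrightarrow> (\<forall>l. \<bar>l\<bar> \<le> radius \<longrightarrow> y (i + l) = x (j + l))"
proof -
  have "(\<forall>k<window. y (i - radius + int k) = x (j - radius + int k)) \<longleftrightarrow> (\<forall>l. \<bar>l\<bar> \<le> radius \<longrightarrow> y (i + l) = x (j + l))"
  proof (intro iffI allI impI)
    fix l assume *: "\<forall>k<window. y (i - radius + int k) = x (j - radius + int k)" and l: "\<bar>l\<bar> \<le> radius"
    then have "nat (l + radius) < window" "int (nat (l + radius)) = l + radius"
      by (auto simp: window_def)
    then show "y (i + l) = x (j + l)" using *[rule_format, of "nat (l + radius)"] by simp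
  next
    fix k assume *: "\<forall>l. \<bar>l\<bar> \<le> radius \<longrightarrow> y (i + l) = x (j + l)" and "k < window"
    then have "\<bar>int k - radius\<bar> \<le> radius" by (auto simp: window_def)
    then have "y (i + (int k - radius)) = x (j + (int k - radius))" using * by blast
    then show "y (i - radius + int k) = x (j - radius + int k)" by (simp add: algebra_simps)
  qed
  then show ?thesis by (simp add: word_eq_iff)
qed

lemma locally_in_pointsI:
  assumes "\<And>i. word y i window \<in> lang points window"
  shows "locally_in_points y"
  unfolding locally_in_points_def
proof
  fix i
  obtain x j where x: "x \<in> R" "word y (i - radius) window = word x j window"
    using assms[of "i - radius"] unfolding lang_points by blast
  then show "\<exists>x\<in>R. \<exists>k. \<forall>l. \<bar>l\<bar> \<le> radius \<longrightarrow> y (i + l) = x (k + l)"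
    using window_eq_iff[of y i x "j + radius"] by (intro bexI[of _ x] exI[of _ "j + radius"]) simp_all
qed

lemma locally_in_points_at_defect:
  assumes "locally_in_points y" "y (i + P) \<noteq> y i"
  obtains x k where "x \<in> R" "- M - P < k" "k < M" "\<not> has_period P x"
    "x (k + P) \<noteq> x k" "\<And>l. \<bar>l\<bar> \<le> radius \<Longrightarrow> y (i + l) = x (k + l)"
proof -
  obtain x k where x: "x \<in> R" and eq: "\<And>l. \<bar>l\<bar> \<le> radius \<Longrightarrow> y (i + l) = x (k + l)"
    using assms(1) unfolding locally_in_points_def by metis
  have "x (k + P) \<noteq> x k"
    using assms(2) eq[of 0] eq[of P] M_nonneg P_pos by (simp add: radius_def)
  with x show ?thesis
    using that[OF x defect_range[OF x] _ _ eq] by (auto simp: has_period_def)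
qed

text \<open>
  Suppose that \<open>y\<close> follows \<open>x\<close> around a defect, and let \<open>l\<close> be the first distance to the right
  at which it leaves \<open>x\<close>. There \<open>x\<close> is already periodic, so \<open>y\<close> has a defect, around which it
  follows some \<open>x'\<close>. Just before this defect \<open>y\<close> still follows the right end of \<open>x\<close> and already
  follows the left end of \<open>x'\<close>, which contradicts the separation of ends.
\<close>

lemma agree_right:
  assumes y: "locally_in_points y" and x: "x \<in> R" and defect: "x (i + P) \<noteq> x i"
    and agree: "\<And>l. \<bar>l\<bar> \<le> radius \<Longrightarrow> y (i' + l) = x (i + l)"
  shows "\<forall>l. 0 \<le> l \<longrightarrow> l \<le> radius + int N \<longrightarrow> y (i' + l) = x (i + l)"
proof (induction N)
  case (Suc N)
  define l where "l = radius + int N + 1"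
  note i = defect_range[OF x defect]
  have "y (i' + l) = x (i + l)"
  proof (rule ccontr)
    assume ne: "y (i' + l) \<noteq> x (i + l)"
    have l: "0 \<le> l - P" "l - P \<le> radius + int N" and "i + l - P \<ge> M"
      using i M_nonneg P_pos by (simp_all add: l_def radius_def)
    then have "x (i + l - P + P) = x (i + l - P)"
      using outside[OF x] unfolding periodic_outside_def by blast
    also have "\<dots> = y (i' + l - P)"
      using Suc.IH l by (simp add: add_diff_eq[symmetric])
    finally have "y (i' + l - P + P) \<noteq> y (i' + l - P)" using ne by simp
    then obtain x' k where x': "x' \<in> R" "\<not> has_period P x'" and k: "- M - P < k" "k < M"
      and eq: "\<And>q. \<bar>q\<bar> \<le> radius \<Longrightarrow> y (i' + l - P + q) = x' (k + q)"
      using locally_in_points_at_defect[OF y] by metis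
    have "x (i + l - P - 2 * M + int q) = x' (k - 2 * M + int q)" if "q < n" for q
    proof -
      have "0 \<le> l - P - 2 * M + int q" "l - P - 2 * M + int q \<le> radius + int N"
        using that n_le M_nonneg P_pos by (simp_all add: l_def radius_def)
      then have "x (i + (l - P - 2 * M + int q)) = y (i' + (l - P - 2 * M + int q))"
        using Suc.IH by simp
      also have "\<dots> = y (i' + l - P + (int q - 2 * M))" by (simp add: algebra_simps)
      also have "\<dots> = x' (k + (int q - 2 * M))"
        using that n_le M_nonneg P_pos by (intro eq) (simp add: radius_def)
      finally show ?thesis by (simp add: algebra_simps)
    qed
    then have "word x (i + l - P - 2 * M) n = word x' (k - 2 * M) n" by (simp add: word_eq_iff)
    moreover have "\<not> has_period P x" using defect by (auto simp: has_period_def)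
    moreover have "i + l - P - 2 * M \<ge> M" "k - 2 * M \<le> - M"
      using i k M_nonneg P_pos by (simp_all add: l_def radius_def)
    ultimately show False using separated x x' by blast
  qed
  then show ?case
    using Suc.IH unfolding l_def by (metis add.assoc add.commute of_nat_Suc zle_add1_eq_le le_less)
qed (use agree in auto)

text \<open>
  The mirror image: to the left of a defect that follows \<open>x\<close>, a first deviation would make \<open>y\<close>
  pass from the right end of some \<open>x'\<close> to the left end of \<open>x\<close>.
\<close>

lemma agree_left:
  assumes y: "locally_in_points y" and x: "x \<in> R" and defect: "x (i + P) \<noteq> x i"
    and agree: "\<And>l. \<bar>l\<bar> \<le> radius \<Longrightarrow> y (i' + l) = x (i + l)"
  shows "\<forall>l. 0 \<le> l \<longrightarrow> l \<le> radius + int N \<longrightarrow> y (i' - l) = x (i - l)"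
proof (induction N)
  case 0
  show ?case using agree[of "- l" for l] by auto
next
  case (Suc N)
  define l where "l = radius + int N + 1"
  note i = defect_range[OF x defect]
  have "y (i' - l) = x (i - l)"
  proof (rule ccontr)
    assume ne: "y (i' - l) \<noteq> x (i - l)"
    have l: "0 \<le> l - P" "l - P \<le> radius + int N" and "i - l + P \<le> - M"
      using i M_nonneg P_pos by (simp_all add: l_def radius_def)
    then have "x (i - l + P - P) = x (i - l + P)"
      using outside[OF x] unfolding periodic_outside_def by blast
    then have "x (i - l) = x (i - (l - P))" by (simp add: algebra_simps)
    also have "\<dots> = y (i' - (l - P))"
      using Suc.IH l by simp
    also have "\<dots> = y (i' - l + P)" by (simp add: algebra_simps)
    finally have "y (i' - l + P) \<noteq> y (i' - l)" using ne by simp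
    then obtain x' k where x': "x' \<in> R" "\<not> has_period P x'" and k: "- M - P < k" "k < M"
      and eq: "\<And>q. \<bar>q\<bar> \<le> radius \<Longrightarrow> y (i' - l + q) = x' (k + q)"
      using locally_in_points_at_defect[OF y] by metis
    have "x (i - l + 2 * M + P + int q) = x' (k + 2 * M + P + int q)" if "q < n" for q
    proof -
      have "0 \<le> l - 2 * M - P - int q" "l - 2 * M - P - int q \<le> radius + int N"
        using that n_le M_nonneg P_pos by (simp_all add: l_def radius_def)
      then have "x (i - (l - 2 * M - P - int q)) = y (i' - (l - 2 * M - P - int q))"
        using Suc.IH by simp
      also have "\<dots> = y (i' - l + (2 * M + P + int q))" by (simp add: algebra_simps)
      also have "\<dots> = x' (k + (2 * M + P + int q))"
        using that n_le M_nonneg P_pos by (intro eq) (simp add: radius_def)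
      finally show ?thesis by (simp add: algebra_simps)
    qed
    then have "word x' (k + 2 * M + P) n = word x (i - l + 2 * M + P) n" by (simp add: word_eq_iff)
    moreover have "\<not> has_period P x" using defect by (auto simp: has_period_def)
    moreover have "k + 2 * M + P \<ge> M" "i - l + 2 * M + P \<le> - M"
      using i k M_nonneg P_pos by (simp_all add: l_def radius_def)
    ultimately show False using separated x x' by blast
  qed
  then show ?case
    using Suc.IH unfolding l_def by (metis add.assoc add.commute of_nat_Suc zle_add1_eq_le le_less)
qed

lemma eq_translate_of_agree_at_defect:
  assumes "locally_in_points y" "x \<in> R" "x (i + P) \<noteq> x i"
    and agree: "\<And>l. \<bar>l\<bar> \<le> radius \<Longrightarrow> y (i' + l) = x (i + l)"
  shows "y = translate (i - i') x"
proof
  fix j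
  show "y j = translate (i - i') x j"
  proof (cases "j \<ge> i'")
    case True
    then have "y (i' + (j - i')) = x (i + (j - i'))"
      using agree_right[OF assms, where N = "nat (j - i')", rule_format, of "j - i'"] M_nonneg P_pos
      by (simp add: radius_def)
    then show ?thesis by (simp add: translate_def algebra_simps)
  next
    case False
    then have "y (i' - (i' - j)) = x (i - (i' - j))"
      using agree_left[OF assms, where N = "nat (i' - j)", rule_format, of "i' - j"] M_nonneg P_pos
      by (simp add: radius_def)
    then show ?thesis by (simp add: translate_def algebra_simps)
  qed
qed

text \<open>
  Whatever its centre, the window has a full period of \<open>y\<close> in one of the two tails of \<open>x\<close>.
\<close>

lemma periodic_window:
  assumes y: "has_period P y" and x: "x \<in> R" and eq: "\<And>l. \<bar>l\<bar> \<le> radius \<Longrightarrow> y l = x (k + l)"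
  obtains z where "z \<in> R" "has_period P z" "y = translate k z"
    "(\<forall>i\<ge>M. z i = x i) \<or> (\<forall>i\<le>-M. z i = x i)"
proof (cases "k \<ge> 0")
  case True
  obtain z where z: "z \<in> R" "has_period P z" "\<forall>i\<ge>M. z i = x i"
    using right_end[OF x] by blast
  have "y (M + q) = z (k + M + q)" if "0 \<le> q" "q < P" for q
    using eq[of "M + q"] z(3) that True M_nonneg by (simp add: radius_def add.assoc)
  from has_period_eq_of_eq_on_period[OF y z(2) P_pos this]
  have "y (M + (j - M)) = z (k + M + (j - M))" for j by blast
  then have "y = translate k z" by (auto simp: translate_def algebra_simps)
  with z that show ?thesis by blast
next
  case False
  obtain z where z: "z \<in> R" "has_period P z" "\<forall>i\<le>-M. z i = x i"
    using left_end[OF x] by blast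
  have "y (- M - P + q) = z (k - M - P + q)" if "0 \<le> q" "q < P" for q
    using eq[of "- M - P + q"] z(3) that False M_nonneg by (simp add: radius_def algebra_simps)
  from has_period_eq_of_eq_on_period[OF y z(2) P_pos this]
  have "y (- M - P + (j + M + P)) = z (k - M - P + (j + M + P))" for j by blast
  then have "y = translate k z" by (auto simp: translate_def algebra_simps)
  with z that show ?thesis by blast
qed

text \<open>
  A sequence with a defect is determined by the member that it follows there, and a sequence
  without defects is the end of a member. So the words of length \<open>window\<close> determine the set of
  points, which is therefore of finite type.
\<close>

lemma locally_in_points_iff: "locally_in_points y \<longleftrightarrow> y \<in> points"
proof
  assume y: "locally_in_points y"
  show "y \<in> points"
  proof (cases "has_period P y")
    case True
    obtain x k where "x \<in> R" "\<And>l. \<bar>l\<bar> \<le> radius \<Longrightarrow> y l = x (k + l)"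
      using y unfolding locally_in_points_def by (metis add_0)
    then obtain z where "z \<in> R" "y = translate k z"
      using periodic_window[OF True] by metis
    then show ?thesis using R_subset_points translate_in_points by blast
  next
    case False
    then obtain i where "y (i + P) \<noteq> y i" by (auto simp: has_period_def)
    then obtain x k where x: "x \<in> R" "x (k + P) \<noteq> x k"
      and eq: "\<And>l. \<bar>l\<bar> \<le> radius \<Longrightarrow> y (i + l) = x (k + l)"
      using locally_in_points_at_defect[OF y] by metis
    have "y = translate (k - i) x" using y x eq by (rule eq_translate_of_agree_at_defect)
    then show ?thesis using R_subset_points[OF x(1)] translate_in_points by blast
  qed
next
  assume "y \<in> points"
  then show "locally_in_points y"
    by (intro locally_in_pointsI) (auto simp: lang_def)
qed

lemma points_eq_words: "points = {y. \<forall>i. word y i window \<in> lang points window}"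
proof (intro equalityI subsetI)
  fix y assume "y \<in> {y. \<forall>i. word y i window \<in> lang points window}"
  then have "locally_in_points y" by (intro locally_in_pointsI) simp
  then show "y \<in> points" by (simp only: locally_in_points_iff)
qed (auto simp: lang_def)

definition letters :: "int set" where "letters = (\<lambda>w. w ! 0) ` lang points 1"

lemma finite_letters: "finite letters"
  by (simp add: letters_def lang_points_finite)

lemma range_subset_letters:
  assumes "y \<in> points"
  shows "range y \<subseteq> letters"
proof
  fix a assume "a \<in> range y"
  then obtain i where "a = word y i 1 ! 0" by auto
  then show "a \<in> letters"
    unfolding letters_def using word_in_lang[OF assms] by (rule image_eqI)
qed

lemma subshift_points: "subshift points"
proof -
  have "closed {y. \<forall>i. word y i window \<in> lang points window}"
    by (intro closed_Collect_all closed_words_in lang_points_finite)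
  then have "closed points" using points_eq_words by simp
  then have "compact ({x. range x \<subseteq> letters} \<inter> points)"
    by (intro compact_Int_closed compact_sequences_over_finite finite_letters)
  moreover have "{x. range x \<subseteq> letters} \<inter> points = points"
    using range_subset_letters by blast
  ultimately show ?thesis
    using shift_points nonempty R_subset_points unfolding subshift_def by fastforce
qed

lemma shift_of_finite_type_points: "shift_of_finite_type points"
proof -
  define Forb where "Forb = {w. set w \<subseteq> letters \<and> length w = window} - lang points window"
  have "points = {x. range x \<subseteq> letters \<and> (\<forall>w\<in>Forb. \<forall>i. word x i (length w) \<noteq> w)}"
  proof (intro equalityI subsetI)
    fix x assume x: "x \<in> points"
    have "word x i (length w) \<noteq> w" if "w \<in> Forb" for w i
      using that word_in_lang[OF x, of i "length w"] by (auto simp: Forb_def)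
    then show "x \<in> {x. range x \<subseteq> letters \<and> (\<forall>w\<in>Forb. \<forall>i. word x i (length w) \<noteq> w)}"
      using range_subset_letters[OF x] by blast
  next
    fix x assume x: "x \<in> {x. range x \<subseteq> letters \<and> (\<forall>w\<in>Forb. \<forall>i. word x i (length w) \<noteq> w)}"
    have "word x i window \<in> lang points window" for i
    proof (rule ccontr)
      assume "word x i window \<notin> lang points window"
      moreover have "set (word x i window) \<subseteq> letters" using x by (auto simp: word_def)
      ultimately have "word x i window \<in> Forb" by (simp add: Forb_def)
      then have "word x i (length (word x i window)) \<noteq> word x i window" using x by blast
      then show False by simp
    qed
    then show "x \<in> points" using points_eq_words by blast
  qed
  moreover have "finite Forb"
    unfolding Forb_def using finite_lists_length_eq[OF finite_letters] by simp
  ultimately show ?thesis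
    unfolding shift_of_finite_type_def using subshift_points finite_letters by blast
qed

text \<open>
  Since the words of length \<open>window\<close> determine the set of points, \<open>X\<close> is contained in it. For the
  converse, an aperiodic member is recovered from its window around a defect. A periodic member
  is found only as an end of some point of \<open>X\<close>, so it is shown instead that all its words occur
  in \<open>X\<close>, which suffices because a subshift is determined by its language.
\<close>

lemma isolated_points:
  assumes X: "subshift X" and lang: "lang X window = lang points window"
  shows "X = points"
proof -
  have local: "locally_in_points y" if "y \<in> X" for y
    using word_in_lang[OF that, of _ window] unfolding lang by (rule locally_in_pointsI)
  have sub: "X \<subseteq> points" using local locally_in_points_iff by blast
  have occurs: "\<exists>y\<in>X. \<exists>j. \<forall>l. \<bar>l\<bar> \<le> radius \<longrightarrow> y (j + l) = x (i + l)" if "x \<in> R" for x i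
  proof -
    have "word x (i - radius) window \<in> lang X window"
      unfolding lang lang_points using that by blast
    then obtain y j where "y \<in> X" "word x (i - radius) window = word y j window"
      by (auto simp: lang_def)
    then show ?thesis
      using window_eq_iff[of y "j + radius" x i] by (intro bexI[of _ y] exI[of _ "j + radius"]) simp_all
  qed
  have words: "word x a m \<in> lang X m" if x: "x \<in> R" for x a m
  proof (cases "has_period P x")
    case True
    obtain y j where y: "y \<in> X" "\<And>l. \<bar>l\<bar> \<le> radius \<Longrightarrow> y (j + l) = x l"
      using occurs[OF x, of 0] by auto
    then obtain x' c where x': "x' \<in> R" "y = translate c x'"
      using sub pointsE by blast
    have "x l = x' (j + c + l)" if "\<bar>l\<bar> \<le> radius" for l
      using y(2)[OF that] by (simp add: x'(2) translate_def algebra_simps)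
    then obtain z where z: "has_period P z" "x = translate (j + c) z"
      and ends: "(\<forall>i\<ge>M. z i = x' i) \<or> (\<forall>i\<le>-M. z i = x' i)"
      using periodic_window[OF True x'(1)] by metis
    have "\<exists>b. word z (a + (j + c)) m = word x' b m"
      using ends word_of_right_end[OF z(1) P_pos] word_of_left_end[OF z(1) P_pos] by metis
    then obtain b where "word x a m = word x' b m" by (auto simp: z(2) word_translate)
    also have "\<dots> = word y (b - c) m" by (simp add: x'(2) word_translate)
    finally show ?thesis using y(1) by (auto simp: lang_def)
  next
    case False
    then obtain i where i: "x (i + P) \<noteq> x i" by (auto simp: has_period_def)
    obtain y j where y: "y \<in> X" "\<And>l. \<bar>l\<bar> \<le> radius \<Longrightarrow> y (j + l) = x (i + l)"
      using occurs[OF x, of i] by blast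
    have "y = translate (i - j) x"
      using local[OF y(1)] x i y(2) by (rule eq_translate_of_agree_at_defect)
    then have "word x a m = word y (a - (i - j)) m" by (simp add: word_translate)
    then show ?thesis using y(1) by (auto simp: lang_def)
  qed
  have "lang X m = lang points m" for m
  proof
    show "lang X m \<subseteq> lang points m" using sub by (auto simp: lang_def)
    show "lang points m \<subseteq> lang X m" unfolding lang_points using words by blast
  qed
  then show ?thesis
    using subshift_subset_of_lang_eq[OF X subshift_points] subshift_subset_of_lang_eq[OF subshift_points X]
    by (intro equalityI) simp_all
qed

end

section \<open>Realizing a language by a separated family\<close>

lemma finite_of_compact_int:
  fixes S :: "int set"
  assumes "compact S"
  shows "finite S"
proof -
  obtain C where "finite C" "S \<subseteq> (\<Union>c\<in>C. {c})"
    by (rule compactE_image[OF assms, of S "\<lambda>a. {a}"]) (auto simp: open_discrete)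
  then show ?thesis by (auto intro: finite_subset)
qed

lemma finite_lang:
  assumes "subshift X"
  shows "finite (lang X n)"
proof -
  let ?A = "(\<lambda>x. x 0) ` X"
  have "compact X" using assms by (simp add: subshift_def)
  moreover have "continuous_on X (\<lambda>x. x 0)"
    using continuous_on_product_coordinates by (rule continuous_on_subset) simp
  ultimately have "compact ?A" by (intro compact_continuous_image)
  then have fin: "finite ?A" by (rule finite_of_compact_int)
  have "x i \<in> ?A" if "x \<in> X" for x i
  proof (rule image_eqI)
    show "(\<lambda>j. x (j + i)) \<in> X"
      using assms that by (intro shift_invariant_translate) (simp_all add: subshift_def)
  qed simp
  then have "lang X n \<subseteq> {w. set w \<subseteq> ?A \<and> length w = n}"
    by (auto simp: lang_def word_def)
  then show ?thesis
    using finite_lists_length_eq[OF fin] finite_subset by blast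
qed

lemma lang_eq_take:
  assumes "k \<le> n"
  shows "lang X k = take k ` lang X n"
proof -
  have "word x i k = take k (word x i n)" for x i
    using assms by (intro nth_equalityI) auto
  then show ?thesis by (auto simp: lang_def image_iff)
qed

lemma lang_eq_mono: "lang X n = lang Y n \<Longrightarrow> k \<le> n \<Longrightarrow> lang X k = lang Y k"
  by (simp add: lang_eq_take)

text \<open>
  The graph whose bi-infinite walks are the sequences all of whose words of length \<open>n\<close> lie in
  \<open>V\<close>: the edges join successive words.
\<close>

definition overlap :: "int list set \<Rightarrow> (int list \<times> int list) set" where
  "overlap V = {(v, w). v \<in> V \<and> w \<in> V \<and> tl v = butlast w}"

lemma word_of_walk:
  assumes walk: "walk (overlap V) \<xi>" and len: "\<And>w. w \<in> V \<Longrightarrow> length w = n" and n: "n > 0"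
  shows "word (\<lambda>i. hd (\<xi> i)) i n = \<xi> i"
proof -
  have step: "length (\<xi> i) = n" "tl (\<xi> i) = butlast (\<xi> (i + 1))" for i
    using walk len by (auto simp: walk_def overlap_def)
  have "\<xi> i ! k = hd (\<xi> (i + int k))" if "k < n" for i k
    using that
  proof (induction k arbitrary: i)
    case 0
    then have "\<xi> i \<noteq> []" using step(1)[of i] by auto
    then show ?case by (simp add: hd_conv_nth)
  next
    case (Suc k)
    have "\<xi> i ! Suc k = tl (\<xi> i) ! k" using Suc.prems step(1)[of i] by (simp add: nth_tl)
    also have "\<dots> = \<xi> (i + 1) ! k"
      using Suc.prems step(1)[of "i + 1"] by (simp add: step(2) nth_butlast)
    also have "\<dots> = hd (\<xi> (i + 1 + int k))" using Suc by simp
    finally show ?case by (simp add: algebra_simps)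
  qed
  then show ?thesis
    using step(1) by (intro nth_equalityI) auto
qed

text \<open>
  The words of length \<open>n\<close> of \<open>X\<close> form a finite graph without dead ends. The family consists of
  the sequences spelled by one periodic or transient walk through each vertex, together with
  their periodic ends, which are included to satisfy the closure conditions of the locale and
  contribute no new words. As there are finitely many walks, common values of \<open>P\<close> and \<open>M\<close> exist.
\<close>

lemma separated_family_of_lang:
  assumes X: "subshift X" and n: "n > 0"
  obtains R P M where "separated_family R P M n" "lang (\<Union>x\<in>R. orbit x) n = lang X n"
proof -
  define V where "V = lang X n"
  define E where "E = overlap V"
  have len: "\<And>w. w \<in> V \<Longrightarrow> length w = n" by (auto simp: V_def lang_def)
  obtain x\<^sub>0 where "x\<^sub>0 \<in> X" using X by (auto simp: subshift_def)
  then have V: "finite V" "V \<noteq> {}"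
    using finite_lang[OF X] word_in_lang[of x\<^sub>0 X 0 n] by (auto simp: V_def)
  have edge: "(word x i n, word x (i + 1) n) \<in> E" if "x \<in> X" for x i
  proof -
    have "tl (word x i n) = butlast (word x (i + 1) n)"
      by (intro nth_equalityI) (auto simp: nth_tl nth_butlast algebra_simps)
    then show ?thesis using word_in_lang[OF that] by (simp add: E_def overlap_def V_def)
  qed
  have succ: "\<exists>u. (v, u) \<in> E" and pred: "\<exists>u. (u, v) \<in> E" if "v \<in> V" for v
  proof -
    from that obtain x i where x: "x \<in> X" "v = word x i n" by (auto simp: V_def lang_def)
    show "\<exists>u. (v, u) \<in> E" "\<exists>u. (u, v) \<in> E"
      using edge[OF x(1), of i] edge[OF x(1), of "i - 1"] x(2) by auto
  qed
  have E: "E \<subseteq> V \<times> V" by (auto simp: E_def overlap_def)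
  have "\<exists>\<xi> p m. walk E \<xi> \<and> v \<in> range \<xi> \<and> p > 0 \<and> periodic_outside p m \<xi> \<and>
      (has_period p \<xi> \<or> transient_walk E v m \<xi>)" if "v \<in> V" for v
    using walk_through_vertex[OF V(1) E that succ pred] by metis
  then obtain \<xi> p m where \<xi>: "\<And>v. v \<in> V \<Longrightarrow> walk E (\<xi> v) \<and> v \<in> range (\<xi> v) \<and> p v > 0 \<and>
      periodic_outside (p v) (m v) (\<xi> v) \<and> (has_period (p v) (\<xi> v) \<or> transient_walk E v (m v) (\<xi> v))"
    by metis
  define P where "P = (\<Prod>v\<in>V. p v)"
  define M where "M = (\<Sum>v\<in>V. \<bar>m v\<bar>) + int n"
  have P: "P > 0" using \<xi> by (auto simp: P_def intro: prod_pos)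
  have dvd: "p v dvd P" if "v \<in> V" for v
    unfolding P_def using V(1) that by (rule dvd_prodI)
  have le: "m v \<le> M" if "v \<in> V" for v
    using member_le_sum[of v V "\<lambda>v. \<bar>m v\<bar>"] V(1) that by (simp add: M_def)
  have M: "M \<ge> 0" "int n \<le> M" by (simp_all add: M_def sum_nonneg)
  define x where "x v = (\<lambda>i. hd (\<xi> v i))" for v
  have word_x: "word (x v) i n = \<xi> v i" if "v \<in> V" for v i
    using word_of_walk[of V "\<xi> v" n i] \<xi>[OF that] len n by (simp add: x_def E_def)
  have out: "periodic_outside P M (x v)" if "v \<in> V" for v
  proof -
    have "periodic_outside P M (\<xi> v)"
      using \<xi>[OF that] periodic_outside_mono[OF _ _ dvd[OF that] P le[OF that]] by blast
    then show ?thesis by (simp add: periodic_outside_def x_def)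
  qed
  have transient: "transient_walk E v M (\<xi> v)" if "v \<in> V" "\<not> has_period P (x v)" for v
  proof -
    have "\<not> has_period (p v) (\<xi> v)"
    proof
      assume "has_period (p v) (\<xi> v)"
      then have "has_period P (\<xi> v)" using has_period_dvd dvd[OF that(1)] by blast
      then show False using that(2) by (simp add: has_period_def x_def)
    qed
    then have "transient_walk E v (m v) (\<xi> v)" using \<xi>[OF that(1)] by simp
    then show ?thesis using le[OF that(1)] by (rule transient_walk_mono)
  qed
  obtain zr where zr: "\<And>v. v \<in> V \<Longrightarrow> has_period P (zr v) \<and> (\<forall>i\<ge>M. zr v i = x v i)"
    using right_end_exists[OF out P] by metis
  obtain zl where zl: "\<And>v. v \<in> V \<Longrightarrow> has_period P (zl v) \<and> (\<forall>i\<le>-M. zl v i = x v i)"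
    using left_end_exists[OF out P] by metis
  define R where "R = x ` V \<union> zr ` V \<union> zl ` V"
  have R_cases: "has_period P y \<or> (\<exists>v\<in>V. y = x v)" if "y \<in> R" for y
    using that zr zl by (auto simp: R_def)
  interpret separated_family R P M n
  proof
    show "finite R" using V(1) by (simp add: R_def)
    show "P > 0" "M \<ge> 0" "int n \<le> M" using P M by simp_all
    show "R \<noteq> {}" using V(2) by (simp add: R_def)
    show "periodic_outside P M y" if "y \<in> R" for y
      using R_cases[OF that] out periodic_outside_of_has_period by blast
    show "\<exists>z\<in>R. has_period P z \<and> (\<forall>i\<ge>M. z i = y i)" if "y \<in> R" for y
      using R_cases[OF that]
    proof
      assume "\<exists>v\<in>V. y = x v"
      then obtain v where v: "v \<in> V" "y = x v" by blast
      then have "zr v \<in> R" by (simp add: R_def)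
      then show ?thesis using zr[OF v(1)] v(2) by blast
    qed (use that in blast)
    show "\<exists>z\<in>R. has_period P z \<and> (\<forall>i\<le>-M. z i = y i)" if "y \<in> R" for y
      using R_cases[OF that]
    proof
      assume "\<exists>v\<in>V. y = x v"
      then obtain v where v: "v \<in> V" "y = x v" by blast
      then have "zl v \<in> R" by (simp add: R_def)
      then show ?thesis using zl[OF v(1)] v(2) by blast
    qed (use that in blast)
    fix y y' i j
    assume y: "y \<in> R" "y' \<in> R" "\<not> has_period P y" "\<not> has_period P y'" and ij: "i \<ge> M" "j \<le> - M"
    obtain v v' where v: "v \<in> V" "y = x v" and v': "v' \<in> V" "y' = x v'"
      using R_cases y by metis
    show "word y i n \<noteq> word y' j n"
      using transient_walks_separated[OF transient[OF v(1)] transient[OF v'(1)] ij] y(3,4)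
      unfolding v(2) v'(2) word_x[OF v(1)] word_x[OF v'(1)] by blast
  qed
  have in_V: "\<xi> v i \<in> V" if "v \<in> V" for v i
    using \<xi>[OF that] E by (auto simp: walk_def)
  have "word y i n \<in> V" if y: "y \<in> R" for y i
  proof -
    have "\<exists>v\<in>V. \<exists>j. word y i n = word (x v) j n"
    proof -
      consider v where "v \<in> V" "y = x v" | v where "v \<in> V" "y = zr v" | v where "v \<in> V" "y = zl v"
        using y by (auto simp: R_def)
      then show ?thesis
      proof cases
        case 1
        then show ?thesis by blast
      next
        case 2
        then obtain j where "word y i n = word (x v) j n"
          using word_of_right_end[of P "zr v" M "x v" i n] zr P by metis
        then show ?thesis using 2 by blast
      next
        case 3
        then obtain j where "word y i n = word (x v) j n"
          using word_of_left_end[of P "zl v" "-M" "x v" i n] zl P by metis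
        then show ?thesis using 3 by blast
      qed
    qed
    then show ?thesis using word_x in_V by auto
  qed
  then have "lang points n \<subseteq> V" unfolding lang_points by blast
  moreover have "V \<subseteq> lang points n"
  proof
    fix v assume v: "v \<in> V"
    then obtain i where "v = word (x v) i n" using \<xi>[OF v] word_x[OF v] by auto
    moreover have "x v \<in> points" using v by (intro R_subset_points) (simp add: R_def)
    ultimately show "v \<in> lang points n" using word_in_lang by metis
  qed
  ultimately have "lang (\<Union>x\<in>R. orbit x) n = lang X n"
    unfolding points_def[symmetric] V_def by blast
  with separated_family_axioms show ?thesis by (rule that)
qed


section \<open>Genericity\<close>

lemma lang_eq_of_subshift_dist_less:
  assumes "subshift_dist X Y < 1 / 2 ^ n"
  shows "lang X n = lang Y n"
proof (rule ccontr)
  assume ne: "lang X n \<noteq> lang Y n"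
  then have "Inf {n. lang X n \<noteq> lang Y n} \<le> n" by (intro wellorder_Inf_le1) simp
  then have "(1 / 2 ^ n :: real) \<le> 1 / 2 ^ Inf {n. lang X n \<noteq> lang Y n}" by (simp add: frac_le)
  moreover have "X \<noteq> Y" using ne by blast
  ultimately show False using assms by (simp add: subshift_dist_def)
qed

lemma subshift_dist_le_of_lang_eq:
  assumes "subshift X" "subshift Y" "lang X n = lang Y n"
  shows "subshift_dist X Y \<le> 1 / 2 ^ n"
proof (cases "X = Y")
  case False
  let ?D = "{n. lang X n \<noteq> lang Y n}"
  have "?D \<noteq> {}"
    using subshift_subset_of_lang_eq[of X Y] subshift_subset_of_lang_eq[of Y X] assms False by auto
  then have "Inf ?D \<in> ?D" by (rule Inf_nat_def1)
  then have "lang X (Inf ?D) \<noteq> lang Y (Inf ?D)" by (rule CollectD)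
  then have "n \<le> Inf ?D" using lang_eq_mono[OF assms(3), of "Inf ?D"] by linarith
  then have "1 / 2 ^ Inf ?D \<le> (1 / 2 ^ n :: real)" by (simp add: frac_le)
  then show ?thesis using False by (simp add: subshift_dist_def)
qed (simp add: subshift_dist_def)

text \<open>
  A subshift that is determined by its words of some length \<open>m\<close> is an isolated point. Any set of
  isolated points is open, so if those with the property \<open>Q\<close> are dense, then \<open>Q\<close> is generic.
\<close>

lemma generic_of_dense_isolated:
  assumes dense: "\<And>X n. subshift X \<Longrightarrow> n > 0 \<Longrightarrow>
    \<exists>Y. subshift Y \<and> Q Y \<and> lang Y n = lang X n \<and>
        (\<exists>m. \<forall>Z. subshift Z \<longrightarrow> lang Z m = lang Y m \<longrightarrow> Z = Y)"
  shows "generic_in subshift_space.mtopology Q"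
proof -
  define G where "G = {Y. subshift Y \<and> Q Y \<and> (\<exists>m. \<forall>Z. subshift Z \<longrightarrow> lang Z m = lang Y m \<longrightarrow> Z = Y)}"
  have "openin subshift_space.mtopology G"
    unfolding subshift_space.openin_mtopology
  proof (intro conjI allI impI)
    show "G \<subseteq> Collect subshift" by (auto simp: G_def)
    fix Y assume Y: "Y \<in> G"
    then obtain m where m: "\<And>Z. subshift Z \<Longrightarrow> lang Z m = lang Y m \<Longrightarrow> Z = Y"
      by (auto simp: G_def)
    have "Z = Y" if "Z \<in> subshift_space.mball Y (1 / 2 ^ m)" for Z
      using that m lang_eq_of_subshift_dist_less[of Y Z m] by simp
    then have "subshift_space.mball Y (1 / 2 ^ m) \<subseteq> G" using Y by blast
    then show "\<exists>r>0. subshift_space.mball Y r \<subseteq> G" by (intro exI[of _ "1 / 2 ^ m"]) simp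
  qed
  then have "gdelta_in subshift_space.mtopology G" by (rule open_imp_gdelta_in)
  moreover have "(subshift_space.mtopology closure_of G) = Collect subshift"
    unfolding subshift_space.metric_closure_of
  proof (intro equalityI subsetI CollectI conjI allI impI)
    fix X and r :: real assume X: "X \<in> Collect subshift" and r: "r > 0"
    obtain n :: nat where n: "(1 / 2) ^ n < r"
      using real_arch_pow_inv[OF r, of "1 / 2"] by auto
    have "subshift X" using X by simp
    then obtain Y where Y: "subshift Y" "Q Y" "lang Y (Suc n) = lang X (Suc n)"
      "\<exists>m. \<forall>Z. subshift Z \<longrightarrow> lang Z m = lang Y m \<longrightarrow> Z = Y"
      using dense[of X "Suc n"] by blast
    have "subshift_dist X Y \<le> 1 / 2 ^ n"
      using \<open>subshift X\<close> Y(1) lang_eq_mono[OF Y(3), of n] by (intro subshift_dist_le_of_lang_eq) simp_all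
    also have "\<dots> < r" using n by (simp add: power_one_over)
    finally have "Y \<in> subshift_space.mball X r" using \<open>subshift X\<close> Y(1) by simp
    moreover have "Y \<in> G" using Y by (simp add: G_def)
    ultimately show "\<exists>Y\<in>G. Y \<in> subshift_space.mball X r" by blast
  qed auto
  moreover have "G \<subseteq> {X. subshift X \<and> Q X}" by (auto simp: G_def)
  ultimately show ?thesis
    unfolding generic_in_def residual_in_def by (auto intro!: exI[of _ G])
qed

theorem theorem1p1:
  shows "generic_in subshift_space.mtopology
    (\<lambda>X. (countable X \<and> shift_of_finite_type X \<and>
          (\<exists>R. finite R \<and> X = (\<Union>x\<in>R. orbit x) \<and> (\<forall>x\<in>R. biasymptotic_to_periodic x)))
       \<and> linear_complexity X
       \<and> virtually_free_abelian_of_finite_rank (Aut X))"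
proof (rule generic_of_dense_isolated)
  fix X and n :: nat assume "subshift X" "n > 0"
  then obtain R P M where "separated_family R P M n" and lang: "lang (\<Union>x\<in>R. orbit x) n = lang X n"
    by (rule separated_family_of_lang)
  then interpret separated_family R P M n by blast
  have "\<exists>R. finite R \<and> points = (\<Union>x\<in>R. orbit x) \<and> (\<forall>x\<in>R. biasymptotic_to_periodic x)"
    using finite_R biasymptotic points_def by blast
  moreover have "\<exists>m. \<forall>Z. subshift Z \<longrightarrow> lang Z m = lang points m \<longrightarrow> Z = points"
    using isolated_points by blast
  ultimately show "\<exists>Y. subshift Y \<and> ((countable Y \<and> shift_of_finite_type Y \<and>
          (\<exists>R. finite R \<and> Y = (\<Union>x\<in>R. orbit x) \<and> (\<forall>x\<in>R. biasymptotic_to_periodic x)))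
       \<and> linear_complexity Y \<and> virtually_free_abelian_of_finite_rank (Aut Y)) \<and>
      lang Y n = lang X n \<and> (\<exists>m. \<forall>Z. subshift Z \<longrightarrow> lang Z m = lang Y m \<longrightarrow> Z = Y)"
    using subshift_points countable_points shift_of_finite_type_points linear_complexity_points
      virtually_free_abelian_Aut_points[OF subshift_points] lang[folded points_def]
    by - (rule exI[of _ points], intro conjI)
qed

end
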